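(* Let $P^1,P^2$ be two almost-surely terminating, integrable probabilistic programs (possibly with conditioning), with the same set of output variables $V_{\mathrm{out}}$, satisfying the bounded cumulative weight property. Let $P^1_{\mathrm{res}},P^2_{\mathrm{res}}$ be the conditioning-free programs obtained from them by weighted restarting, and let the initial states of $\mathcal{C}(P^1_{\mathrm{res}})$ and $\mathcal{C}(P^2_{\mathrm{res}})$ be $(\ell^1_{\mathrm{in}},\mathbf{x}^1_{\mathrm{in}})$ and $(\ell^2_{\mathrm{in}},\mathbf{x}^2_{\mathrm{in}})$, respectively. Assume that there exist a Borel-measurable function $f:\mathbb{R}^{|V_{\mathrm{out}}|}\to\mathbb{R}$ and two state functions, $U_f$ for $\mathcal{C}(P^1_{\mathrm{res}})$ and $L_f$ for $\mathcal{C}(P^2_{\mathrm{res}})$, such that: (i) $U_f$ is a UESM for $f$ in $\mathcal{C}(P^1_{\mathrm{res}})$ (with respect to some invariant) and $(\mathcal{C}(P^1_{\mathrm{res}}),U_f,f)$ is OST-sound; (ii) $L_f$ is an LESM for $f$ in $\mathcal{C}(P^2_{\mathrm{res}})$ (with respect to some invariant) and $(\mathcal{C}(P^2_{\mathrm{res}}),L_f,f)$ is OST-sound; (iii) $U_f(\ell^1_{\mathrm{in}},\mathbf{x}^1_{\mathrm{in}})+f((\mathbf{x}^1_{\mathrm{in}})^{\mathrm{out}})<L_f(\ell^2_{\mathrm{in}},\mathbf{x}^2_{\mathrm{in}})+f((\mathbf{x}^2_{\mathrm{in}})^{\mathrm{out}})$. Then $P^1,P^2$ are not output equivalent, i.e.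 there is a Borel set $B\subseteq\mathbb{R}^{|V_{\mathrm{out}}|}$ with $\mu^{\mathcal{C}(P^1)}[B]\neq\mu^{\mathcal{C}(P^2)}[B]$.
   Context: **Programs and pCFGs.** A probabilistic program (PP) is an imperative program over finitely many integer- or real-valued variables with assignments, if-branching, loops, sequential composition, go-to, sampling assignments $x:=\mathbf{sample}(d)$ ($d$ a probability distribution on $\mathbb{R}$, discrete or continuous), and conditioning instructions $\mathbf{observe}(\phi)$ ($\phi$ a predicate over program variables) and $\mathbf{score}(e)$ ($e$ a non-negative expression over program variables). All expressions are Borel-measurable. A PP is conditioning-free if it has no observe/score instructions. Probabilistic branching $\mathbf{if\ prob}(p)$ is syntactic sugar for sampling followed by conditional branching. All notions for a PP $P$ are defined via its probabilistic control-flow graph (pCFG) $\mathcal{C}(P)$. A pCFG is a tuple $\mathcal{C}=(L,V,V_{\mathrm{out}},\ell_{\mathrm{in}},\mathbf{x}_{\mathrm{in}},\mapsto,G,Up,w,\ell_{\mathrm{out}})$: $L$ a finite set of locations; $V$ a finite set of variables; $V_{\mathrm{out}}\subseteq V$ the output variables; $\ell_{\mathrm{in}}\in L$ the initial location; $\mathbf{x}_{\mathrm{in}}\in\mathbb{R}^{|V|}$ the initial valuation; $\mapsto\,\subseteq L\times L$ the transitions; $G$ assigns each transition a guard (a predicate over $V$); $Up$ assigns each transition and each variable either $\bot$ (no change), a Borel-measurable expression $u:\mathbb{R}^{|V|}\to\mathbb{R}$ (deterministic update), or a probability distribution on $\mathbb{R}$ (fresh independent sample); $w:\,\mapsto\times\mathbb{R}^{|V|}\to[0,\infty)$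 is the weighting function; $\ell_{\mathrm{out}}\in L$ is the terminal location. At each state $(\ell,\mathbf{x})\in L\times\mathbb{R}^{|V|}$ exactly one transition $\tau=(\ell,\ell')$ is enabled (i.e. satisfies $\mathbf{x}\models G(\tau)$); the only transition out of $\ell_{\mathrm{out}}$ is a self-loop with no variable update and weight $1$. In $\mathcal{C}(P)$, locations correspond to instructions and transitions encode their effect; $w(\tau,\mathbf{x})=e(\mathbf{x})$ if $\tau$ encodes $\mathbf{score}(e)$; $w(\tau,\mathbf{x})=1$ if $\mathbf{x}\models\phi$ and $0$ otherwise if $\tau$ encodes $\mathbf{observe}(\phi)$; $w(\tau,\mathbf{x})=1$ for all other $\tau$. **Runs and semantics.** A state $(\ell',\mathbf{x}')$ is a successor of $(\ell,\mathbf{x})$ if $\mathbf{x}'$ is a possible result of applying the update of the enabled transition $(\ell,\ell')$ to $\mathbf{x}$. A state is reachable if it is the last state of a finite sequence of successive states starting in $(\ell_{\mathrm{in}},\mathbf{x}_{\mathrm{in}})$. A run is an infinite sequence of successive states starting in $(\ell_{\mathrm{in}},\mathbf{x}_{\mathrm{in}})$. The pCFG defines a discrete-time Markov process on states started in $(\ell_{\mathrm{in}},\mathbf{x}_{\mathrm{in}})$, giving a probability measure $\mathbb{P}^{\mathcal{C}}$ on runs with expectation $\mathbb{E}^{\mathcal{C}}$. A run is terminating if it reaches $\ell_{\mathrm{out}}$; its termination time $T(\rho)$ is the first index $i$ with $\ell_i=\ell_{\mathrm{out}}$ ($\infty$ if none). The cumulative weight of a terminating run $\rho=(\ell_0,\mathbf{x}_0),(\ell_1,\mathbf{x}_1),\dots$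 is $W(\rho)=\prod_{i=0}^{T(\rho)-1}w((\ell_i,\ell_{i+1}),\mathbf{x}_i)$. $\mathcal{C}$ (or $P$) is: almost-surely (a.s.) terminating if $\mathbb{P}^{\mathcal{C}}[T<\infty]=1$; integrable if $0<\mathbb{E}^{\mathcal{C}}[W]<\infty$; it satisfies the bounded cumulative weight property (with bound $M$) if there is $M>0$ with $W(\rho)\le M$ for every terminating run $\rho$. **Normalized output distribution (NOD).** For a valuation $\mathbf{x}$, $\mathbf{x}^{\mathrm{out}}$ is its projection to the variables in $V_{\mathrm{out}}$. For Borel $B\subseteq\mathbb{R}^{|V_{\mathrm{out}}|}$ let $\mathrm{Output}(B)$ be the set of runs reaching some terminal state $(\ell_{\mathrm{out}},\mathbf{x})$ with $\mathbf{x}^{\mathrm{out}}\in B$. For $\mathcal{C}$ a.s. terminating and integrable, $\mu^{\mathcal{C}}[B]=\mathbb{E}^{\mathcal{C}}[\mathbf{1}_{\mathrm{Output}(B)}\cdot W]/\mathbb{E}^{\mathcal{C}}[W]$. **Weighted restarting.** Given $P$ with bound $M$, the PP $P_{\mathrm{res}}$ is obtained by: (1) adding a fresh non-output variable $\omega$ (the weight variable), initially $1$; (2) replacing each $\mathbf{observe}(\phi)$ by "if $\neg\phi$: $\omega:=0$"; (3) replacing each $\mathbf{score}(e)$ by $\omega:=\omega\cdot e$; (4) adding at the end of the program: "$\mathbf{if\ prob}(1-\omega/M)$: $\mathbf{x}:=\mathbf{x}_{\mathrm{in}}$; $\omega:=1$; go-to $\ell_{\mathrm{in}}$" (otherwise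 the program terminates). On the level of pCFGs this can be realized as follows: every transition $\tau$ of $\mathcal{C}(P)$ not leaving $\ell_{\mathrm{out}}$ is kept, with the additional update $\omega:=\omega\cdot w(\tau,\mathbf{x})$; the old terminal location is no longer terminal, and from it a fresh non-output variable $u$ is sampled uniformly from $[0,1]$; then if $u<1-\omega/M$ the run moves to $\ell_{\mathrm{in}}$ with all variables reset to $\mathbf{x}_{\mathrm{in}}$ and $\omega:=1$, and otherwise moves to a new terminal location with variables unchanged; all transition weights are $1$. The output variables are unchanged. **State functions, invariants, UESM, LESM.** A state function $\eta$ in $\mathcal{C}$ assigns to each location $\ell$ a Borel-measurable function $\eta(\ell,\cdot):\mathbb{R}^{|V|}\to\mathbb{R}$. An invariant $I$ assigns to each location a predicate $I(\ell)$ over $V$ such that $\mathbf{x}\models I(\ell)$ for each reachable state $(\ell,\mathbf{x})$. Let $\mathcal{C}$ be a.s. terminating and $f:\mathbb{R}^{|V_{\mathrm{out}}|}\to\mathbb{R}$ Borel-measurable. An upper expectation supermartingale (UESM) for $f$ with respect to $I$ is a state function $U_f$ such that: (1) $U_f(\ell_{\mathrm{out}},\mathbf{x})=0$ for every $\mathbf{x}\models I(\ell_{\mathrm{out}})$; (2) for every transition $\tau=(\ell,\ell')$ and every $\mathbf{x}\models I(\ell)\wedge G(\tau)$, writing $\mathbf{N}$ for the random valuation resulting from performing $\tau$ from $(\ell,\mathbf{x})$, $U_f(\ell,\mathbf{x})+f(\mathbf{x}^{\mathrm{out}})\ge\mathbb{E}[U_f(\ell',\mathbf{N})+f(\mathbf{N}^{\mathrm{out}})]$.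 A lower expectation submartingale (LESM) $L_f$ for $f$ is defined in the same way with (2) replaced by $L_f(\ell,\mathbf{x})+f(\mathbf{x}^{\mathrm{out}})\le\mathbb{E}[L_f(\ell',\mathbf{N})+f(\mathbf{N}^{\mathrm{out}})]$. The expectations are understood to be well defined. **OST-soundness.** Here $\mathbb{N}=\{1,2,\dots\}$. For a pCFG $\mathcal{C}$, a state function $\eta$ in $\mathcal{C}$ and a Borel-measurable function $f:\mathbb{R}^{|V_{\mathrm{out}}|}\to\mathbb{R}$, let $S_i$ and $\mathbf{x}_i$ be the $i$-th state and $i$-th valuation along a run, $Y_i=\eta(S_i)+f(\mathbf{x}_i^{\mathrm{out}})$ for $i\ge0$, and $\mathcal{F}_t$ the $\sigma$-algebra generated by the first $t$ steps. $(\mathcal{C},\eta,f)$ is OST-sound if $\mathbb{E}[|Y_i|]<\infty$ for every $i\ge0$ and at least one of the following holds: (C1) there is a constant $c$ with $T\le c$ with probability $1$; (C2) there is a constant $c$ such that $|Y_{\min\{t,T(\rho)\}}(\rho)|\le c$ for each $t\in\mathbb{N}$ and each run $\rho$; (C3) $\mathbb{E}[T]<\infty$ and there is a constant $c$ such that $\mathbb{E}[|Y_{t+1}-Y_t|\mid\mathcal{F}_t]\le c$ for every $t\in\mathbb{N}$; (C4) there are real numbers $M,c_1,c_2,d$ with $c_2>0$ such that $\mathbb{P}(T>n)\le c_1e^{-c_2n}$ for all sufficiently large $n\in\mathbb{N}$, and $|Y_{n+1}-Y_n|\le M\cdot n^d$ for all $n\in\mathbb{N}$. *)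

theory Defs
  imports "HOL-Probability.Probability"
begin

section \<open>Probabilistic control-flow graphs\<close>

text \<open>
  Programs enter only through their control-flow graphs: observe and score instructions appear as
  the weighting function \<open>wt\<close>, and a conditioning-free program has weight 1 on all transitions.

  A valuation of a finite set \<open>V\<close> of variables is a point of \<open>\<real>\<^sup>V\<close>, rendered as an element of
  \<^term>\<open>space (Pi\<^sub>M V (\<lambda>_. borel :: real measure))\<close>; the projection to a subset \<open>W\<close> of the variables
  is \<^term>\<open>\<lambda>x. restrict x W\<close>.
\<close>

datatype 'v update =
    Keep
  | Det "('v \<Rightarrow> real) \<Rightarrow> real"
  | Sample "real measure"

record ('l, 'v) pcfg =
  locs :: "'l set"
  vars :: "'v set"
  outs :: "'v set"
  init_loc :: 'l
  init_val :: "'v \<Rightarrow> real"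
  trans :: "('l \<times> 'l) set"
  guard :: "'l \<times> 'l \<Rightarrow> ('v \<Rightarrow> real) \<Rightarrow> bool"
  upd :: "'l \<times> 'l \<Rightarrow> 'v \<Rightarrow> 'v update"
  wt :: "'l \<times> 'l \<Rightarrow> ('v \<Rightarrow> real) \<Rightarrow> real"
  term_loc :: 'l

abbreviation valuations :: "'v set \<Rightarrow> ('v \<Rightarrow> real) measure" where
  "valuations V \<equiv> Pi\<^sub>M V (\<lambda>_. borel)"

definition enabled :: "('l, 'v) pcfg \<Rightarrow> 'l \<Rightarrow> ('v \<Rightarrow> real) \<Rightarrow> 'l \<Rightarrow> bool" where
  "enabled C l x l' \<longleftrightarrow> (l, l') \<in> trans C \<and> guard C (l, l') x"

locale wf_pcfg =
  fixes C :: "('l, 'v) pcfg"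
  assumes finite_locs: "finite (locs C)"
    and finite_vars: "finite (vars C)"
    and outs_subset: "outs C \<subseteq> vars C"
    and init_loc_in: "init_loc C \<in> locs C"
    and init_val_in: "init_val C \<in> space (valuations (vars C))"
    and term_loc_in: "term_loc C \<in> locs C"
    and trans_subset: "trans C \<subseteq> locs C \<times> locs C"
    and guard_measurable:
      "\<And>\<tau>. \<tau> \<in> trans C \<Longrightarrow> Measurable.pred (valuations (vars C)) (guard C \<tau>)"
    and Det_measurable:
      "\<And>\<tau> v e. \<tau> \<in> trans C \<Longrightarrow> v \<in> vars C \<Longrightarrow> upd C \<tau> v = Det e \<Longrightarrow>
        e \<in> borel_measurable (valuations (vars C))"
    and Sample_distribution:
      "\<And>\<tau> v d. \<tau> \<in> trans C \<Longrightarrow> v \<in> vars C \<Longrightarrow> upd C \<tau> v = Sample d \<Longrightarrow> real_distribution d"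
    and wt_measurable:
      "\<And>\<tau>. \<tau> \<in> trans C \<Longrightarrow> wt C \<tau> \<in> borel_measurable (valuations (vars C))"
    and wt_nonneg:
      "\<And>\<tau> x. \<tau> \<in> trans C \<Longrightarrow> x \<in> space (valuations (vars C)) \<Longrightarrow> 0 \<le> wt C \<tau> x"
    and ex1_enabled:
      "\<And>l x. l \<in> locs C \<Longrightarrow> x \<in> space (valuations (vars C)) \<Longrightarrow> \<exists>!l'. enabled C l x l'"
    and term_loop: "\<And>l'. (term_loc C, l') \<in> trans C \<Longrightarrow> l' = term_loc C"
    and term_upd: "\<And>v. v \<in> vars C \<Longrightarrow> upd C (term_loc C, term_loc C) v = Keep"
    and term_wt:
      "\<And>x. x \<in> space (valuations (vars C)) \<Longrightarrow> wt C (term_loc C, term_loc C) x = 1"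

section \<open>Runs\<close>

type_synonym ('l, 'v) state = "'l \<times> ('v \<Rightarrow> real)"

abbreviation init_state :: "('l, 'v) pcfg \<Rightarrow> ('l, 'v) state" where
  "init_state C \<equiv> (init_loc C, init_val C)"

text \<open>
  The values that may result from sampling from \<open>d\<close> are the points of the topological support
  of \<open>d\<close>; a sample lies in this set with probability 1.
\<close>

definition msupport :: "real measure \<Rightarrow> real set" where
  "msupport d = {r. \<forall>U. open U \<longrightarrow> r \<in> U \<longrightarrow> emeasure d U > 0}"

fun possible_values :: "'v update \<Rightarrow> ('v \<Rightarrow> real) \<Rightarrow> 'v \<Rightarrow> real set" where
  "possible_values Keep x v = {x v}"
| "possible_values (Det e) x v = {e x}"
| "possible_values (Sample d) x v = msupport d"

definition successor :: "('l, 'v) pcfg \<Rightarrow> ('l, 'v) state \<Rightarrow> ('l, 'v) state \<Rightarrow> bool" where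
  "successor C = (\<lambda>(l, x) (l', x').
     x \<in> space (valuations (vars C)) \<and> x' \<in> space (valuations (vars C)) \<and> enabled C l x l' \<and>
     (\<forall>v\<in>vars C. x' v \<in> possible_values (upd C (l, l') v) x v))"

definition reachable :: "('l, 'v) pcfg \<Rightarrow> ('l, 'v) state \<Rightarrow> bool" where
  "reachable C s \<longleftrightarrow> (successor C)\<^sup>*\<^sup>* (init_state C) s"

definition runs :: "('l, 'v) pcfg \<Rightarrow> (nat \<Rightarrow> ('l, 'v) state) set" where
  "runs C = {\<rho>. \<rho> 0 = init_state C \<and> (\<forall>i. successor C (\<rho> i) (\<rho> (Suc i)))}"

definition term_time :: "('l, 'v) pcfg \<Rightarrow> (nat \<Rightarrow> ('l, 'v) state) \<Rightarrow> enat" where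
  "term_time C \<rho> =
     (if \<exists>i. fst (\<rho> i) = term_loc C then enat (LEAST i. fst (\<rho> i) = term_loc C) else \<infinity>)"

text \<open>The cumulative weight is defined for terminating runs only; it is set to 0 elsewhere.\<close>

definition cum_weight :: "('l, 'v) pcfg \<Rightarrow> (nat \<Rightarrow> ('l, 'v) state) \<Rightarrow> real" where
  "cum_weight C \<rho> =
     (if \<rho> \<in> runs C \<and> term_time C \<rho> < \<infinity>
      then \<Prod>i<the_enat (term_time C \<rho>). wt C (fst (\<rho> i), fst (\<rho> (Suc i))) (snd (\<rho> i))
      else 0)"

section \<open>The probability measure on runs\<close>

fun value_dist :: "'v update \<Rightarrow> ('v \<Rightarrow> real) \<Rightarrow> 'v \<Rightarrow> real measure" where
  "value_dist Keep x v = return borel (x v)"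
| "value_dist (Det e) x v = return borel (e x)"
| "value_dist (Sample d) x v = d"

text \<open>
  The law of the valuation obtained by performing a transition: the variables are updated
  simultaneously, and the samples are independent.
\<close>

definition next_val :: "('l, 'v) pcfg \<Rightarrow> 'l \<times> 'l \<Rightarrow> ('v \<Rightarrow> real) \<Rightarrow> ('v \<Rightarrow> real) measure" where
  "next_val C \<tau> x = Pi\<^sub>M (vars C) (\<lambda>v. value_dist (upd C \<tau> v) x v)"

definition state_space :: "('l, 'v) pcfg \<Rightarrow> ('l, 'v) state measure" where
  "state_space C = count_space (locs C) \<Otimes>\<^sub>M valuations (vars C)"

definition step :: "('l, 'v) pcfg \<Rightarrow> ('l, 'v) state \<Rightarrow> ('l, 'v) state measure" where
  "step C = (\<lambda>(l, x). let l' = (THE l'. enabled C l x l')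
     in distr (next_val C (l, l') x) (state_space C) (Pair l'))"

definition history_kernel ::
    "('l, 'v) pcfg \<Rightarrow> nat \<Rightarrow> (nat \<Rightarrow> ('l, 'v) state) \<Rightarrow> ('l, 'v) state measure" where
  "history_kernel C i \<omega> =
     (case i of 0 \<Rightarrow> return (state_space C) (init_state C) | Suc j \<Rightarrow> step C (\<omega> j))"

text \<open>
  The law of the Markov process, on the space of all sequences of states; the sequences that are
  not runs form a null set.
\<close>

definition run_measure :: "('l, 'v) pcfg \<Rightarrow> (nat \<Rightarrow> ('l, 'v) state) measure" where
  "run_measure C = projective_family.lim UNIV
     (Ionescu_Tulcea.CI (history_kernel C) (\<lambda>_. state_space C)) (\<lambda>_. state_space C)"

definition as_terminating :: "('l, 'v) pcfg \<Rightarrow> bool" where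
  "as_terminating C \<longleftrightarrow> (AE \<rho> in run_measure C. term_time C \<rho> < \<infinity>)"

definition integrable_pcfg :: "('l, 'v) pcfg \<Rightarrow> bool" where
  "integrable_pcfg C \<longleftrightarrow> integrable (run_measure C) (cum_weight C) \<and>
     0 < (\<integral>\<rho>. cum_weight C \<rho> \<partial>run_measure C)"

definition weight_bound :: "('l, 'v) pcfg \<Rightarrow> real \<Rightarrow> bool" where
  "weight_bound C M \<longleftrightarrow>
     0 < M \<and> (\<forall>\<rho>\<in>runs C. term_time C \<rho> < \<infinity> \<longrightarrow> cum_weight C \<rho> \<le> M)"

definition output_runs ::
    "('l, 'v) pcfg \<Rightarrow> ('v \<Rightarrow> real) set \<Rightarrow> (nat \<Rightarrow> ('l, 'v) state) set" where
  "output_runs C B =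
     {\<rho>\<in>runs C. \<exists>i x. \<rho> i = (term_loc C, x) \<and> restrict x (outs C) \<in> B}"

definition nod :: "('l, 'v) pcfg \<Rightarrow> ('v \<Rightarrow> real) set \<Rightarrow> real" where
  "nod C B = (\<integral>\<rho>. indicator (output_runs C B) \<rho> * cum_weight C \<rho> \<partial>run_measure C) /
     (\<integral>\<rho>. cum_weight C \<rho> \<partial>run_measure C)"

section \<open>Weighted restarting\<close>

text \<open>
  \<open>Old l\<close> are the original locations, \<open>Decide\<close> is the location reached after sampling the
  variable that decides about the restart, and \<open>Stop\<close> is the new terminal location.
\<close>

datatype 'l rloc = Old 'l | Decide | Stop

fun lift_update :: "'v set \<Rightarrow> 'v update \<Rightarrow> 'v update" where
  "lift_update V Keep = Keep"
| "lift_update V (Det e) = Det (\<lambda>x. e (restrict x V))"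
| "lift_update V (Sample d) = Sample d"

text \<open>
  The parameters \<open>\<omega>\<close> and \<open>u\<close> of the construction are the names of the weight variable and of the
  variable that is sampled uniformly; they are meant to be distinct and not in \<^term>\<open>vars C\<close>.
  The initial value of \<open>u\<close> is immaterial, since \<open>u\<close> is only read after it has been sampled; it is 0.
\<close>

definition restart_trans :: "('l, 'v) pcfg \<Rightarrow> ('l rloc \<times> 'l rloc) set" where
  "restart_trans C =
     {(Old l, Old l') |l l'. (l, l') \<in> trans C \<and> l \<noteq> term_loc C} \<union>
     {(Old (term_loc C), Decide), (Decide, Old (init_loc C)), (Decide, Stop), (Stop, Stop)}"

definition restart_guard ::
    "('l, 'v) pcfg \<Rightarrow> real \<Rightarrow> 'v \<Rightarrow> 'v \<Rightarrow> 'l rloc \<times> 'l rloc \<Rightarrow> ('v \<Rightarrow> real) \<Rightarrow> bool" where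
  "restart_guard C M \<omega> u \<tau> x = (case \<tau> of
       (Old l, Old l') \<Rightarrow> guard C (l, l') (restrict x (vars C))
     | (Decide, Old l) \<Rightarrow> x u < 1 - x \<omega> / M
     | (Decide, Stop) \<Rightarrow> \<not> x u < 1 - x \<omega> / M
     | _ \<Rightarrow> True)"

definition restart_init_val :: "('l, 'v) pcfg \<Rightarrow> 'v \<Rightarrow> 'v \<Rightarrow> 'v \<Rightarrow> real" where
  "restart_init_val C \<omega> u = (init_val C)(\<omega> := 1, u := 0)"

definition restart_upd ::
    "('l, 'v) pcfg \<Rightarrow> 'v \<Rightarrow> 'v \<Rightarrow> 'l rloc \<times> 'l rloc \<Rightarrow> 'v \<Rightarrow> 'v update" where
  "restart_upd C \<omega> u \<tau> v = (case \<tau> of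
       (Old l, Old l') \<Rightarrow>
         if v = \<omega> then Det (\<lambda>x. x \<omega> * wt C (l, l') (restrict x (vars C)))
         else if v = u then Keep
         else lift_update (vars C) (upd C (l, l') v)
     | (Old l, Decide) \<Rightarrow> if v = u then Sample (uniform_measure lborel {0..1}) else Keep
     | (Decide, Old l) \<Rightarrow> Det (\<lambda>_. restart_init_val C \<omega> u v)
     | _ \<Rightarrow> Keep)"

definition restart :: "('l, 'v) pcfg \<Rightarrow> real \<Rightarrow> 'v \<Rightarrow> 'v \<Rightarrow> ('l rloc, 'v) pcfg" where
  "restart C M \<omega> u = \<lparr>
     locs = Old ` locs C \<union> {Decide, Stop},
     vars = insert \<omega> (insert u (vars C)),
     outs = outs C,
     init_loc = Old (init_loc C),
     init_val = restart_init_val C \<omega> u,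
     trans = restart_trans C,
     guard = restart_guard C M \<omega> u,
     upd = restart_upd C \<omega> u,
     wt = (\<lambda>_ _. 1),
     term_loc = Stop\<rparr>"

section \<open>Expectation super- and submartingales\<close>

type_synonym ('l, 'v) state_fun = "'l \<Rightarrow> ('v \<Rightarrow> real) \<Rightarrow> real"

definition state_function :: "('l, 'v) pcfg \<Rightarrow> ('l, 'v) state_fun \<Rightarrow> bool" where
  "state_function C \<eta> \<longleftrightarrow> (\<forall>l\<in>locs C. \<eta> l \<in> borel_measurable (valuations (vars C)))"

definition invariant :: "('l, 'v) pcfg \<Rightarrow> ('l \<Rightarrow> ('v \<Rightarrow> real) \<Rightarrow> bool) \<Rightarrow> bool" where
  "invariant C I \<longleftrightarrow> (\<forall>l x. reachable C (l, x) \<longrightarrow> I l x)"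

text \<open>
  Expectations in the one-step conditions are taken in \<open>[-\<infinity>, \<infinity>]\<close> and are well defined unless
  both the positive and the negative part have infinite integral.
\<close>

definition has_expectation :: "'a measure \<Rightarrow> ('a \<Rightarrow> real) \<Rightarrow> bool" where
  "has_expectation N g \<longleftrightarrow> g \<in> borel_measurable N \<and>
     ((\<integral>\<^sup>+y. ennreal (g y) \<partial>N) < \<infinity> \<or> (\<integral>\<^sup>+y. ennreal (- g y) \<partial>N) < \<infinity>)"

definition ext_expectation :: "'a measure \<Rightarrow> ('a \<Rightarrow> real) \<Rightarrow> ereal" where
  "ext_expectation N g =
     enn2ereal (\<integral>\<^sup>+y. ennreal (g y) \<partial>N) - enn2ereal (\<integral>\<^sup>+y. ennreal (- g y) \<partial>N)"

definition UESM :: "('l, 'v) pcfg \<Rightarrow> ('l \<Rightarrow> ('v \<Rightarrow> real) \<Rightarrow> bool) \<Rightarrow> (('v \<Rightarrow> real) \<Rightarrow> real) \<Rightarrow>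
    ('l, 'v) state_fun \<Rightarrow> bool" where
  "UESM C I f U \<longleftrightarrow> state_function C U \<and>
     (\<forall>x\<in>space (valuations (vars C)). I (term_loc C) x \<longrightarrow> U (term_loc C) x = 0) \<and>
     (\<forall>(l, l')\<in>trans C. \<forall>x\<in>space (valuations (vars C)). I l x \<and> guard C (l, l') x \<longrightarrow>
        has_expectation (next_val C (l, l') x) (\<lambda>y. U l' y + f (restrict y (outs C))) \<and>
        ereal (U l x + f (restrict x (outs C))) \<ge>
        ext_expectation (next_val C (l, l') x) (\<lambda>y. U l' y + f (restrict y (outs C))))"

definition LESM :: "('l, 'v) pcfg \<Rightarrow> ('l \<Rightarrow> ('v \<Rightarrow> real) \<Rightarrow> bool) \<Rightarrow> (('v \<Rightarrow> real) \<Rightarrow> real) \<Rightarrow>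
    ('l, 'v) state_fun \<Rightarrow> bool" where
  "LESM C I f L \<longleftrightarrow> state_function C L \<and>
     (\<forall>x\<in>space (valuations (vars C)). I (term_loc C) x \<longrightarrow> L (term_loc C) x = 0) \<and>
     (\<forall>(l, l')\<in>trans C. \<forall>x\<in>space (valuations (vars C)). I l x \<and> guard C (l, l') x \<longrightarrow>
        has_expectation (next_val C (l, l') x) (\<lambda>y. L l' y + f (restrict y (outs C))) \<and>
        ereal (L l x + f (restrict x (outs C))) \<le>
        ext_expectation (next_val C (l, l') x) (\<lambda>y. L l' y + f (restrict y (outs C))))"

section \<open>OST-soundness\<close>

definition ost_process :: "('l, 'v) pcfg \<Rightarrow> ('l, 'v) state_fun \<Rightarrow> (('v \<Rightarrow> real) \<Rightarrow> real) \<Rightarrow>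
    nat \<Rightarrow> (nat \<Rightarrow> ('l, 'v) state) \<Rightarrow> real" where
  "ost_process C \<eta> f i \<rho> =
     \<eta> (fst (\<rho> i)) (snd (\<rho> i)) + f (restrict (snd (\<rho> i)) (outs C))"

text \<open>The \<open>\<sigma>\<close>-algebra generated by the states with index at most \<open>t\<close>.\<close>

definition filt :: "('l, 'v) pcfg \<Rightarrow> nat \<Rightarrow> (nat \<Rightarrow> ('l, 'v) state) measure" where
  "filt C t = vimage_algebra (space (run_measure C)) (\<lambda>\<rho>. restrict \<rho> {..t})
     (Pi\<^sub>M {..t} (\<lambda>_. state_space C))"

text \<open>
  In the conditions (C2)--(C4) the index \<open>t\<close> (resp. \<open>n\<close>) ranges over the positive integers.
\<close>

definition ost_C1 :: "('l, 'v) pcfg \<Rightarrow> bool" where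
  "ost_C1 C \<longleftrightarrow> (\<exists>c::nat. AE \<rho> in run_measure C. term_time C \<rho> \<le> enat c)"

definition ost_C2 ::
    "('l, 'v) pcfg \<Rightarrow> ('l, 'v) state_fun \<Rightarrow> (('v \<Rightarrow> real) \<Rightarrow> real) \<Rightarrow> bool" where
  "ost_C2 C \<eta> f \<longleftrightarrow> (\<exists>c::real. \<forall>t\<ge>1. \<forall>\<rho>\<in>runs C.
     \<bar>ost_process C \<eta> f (the_enat (min (enat t) (term_time C \<rho>))) \<rho>\<bar> \<le> c)"

definition ost_C3 ::
    "('l, 'v) pcfg \<Rightarrow> ('l, 'v) state_fun \<Rightarrow> (('v \<Rightarrow> real) \<Rightarrow> real) \<Rightarrow> bool" where
  "ost_C3 C \<eta> f \<longleftrightarrow>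
     (\<integral>\<^sup>+\<rho>. ennreal_of_enat (term_time C \<rho>) \<partial>run_measure C) < \<infinity> \<and>
     (\<exists>c::real. \<forall>t\<ge>1. AE \<rho> in run_measure C.
        real_cond_exp (run_measure C) (filt C t)
          (\<lambda>\<rho>. \<bar>ost_process C \<eta> f (Suc t) \<rho> - ost_process C \<eta> f t \<rho>\<bar>) \<rho> \<le> c)"

definition ost_C4 ::
    "('l, 'v) pcfg \<Rightarrow> ('l, 'v) state_fun \<Rightarrow> (('v \<Rightarrow> real) \<Rightarrow> real) \<Rightarrow> bool" where
  "ost_C4 C \<eta> f \<longleftrightarrow> (\<exists>M c\<^sub>1 c\<^sub>2 d :: real. c\<^sub>2 > 0 \<and>
     (\<forall>\<^sub>F n :: nat in sequentially.
        measure (run_measure C) {\<rho>\<in>space (run_measure C). term_time C \<rho> > enat n}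
          \<le> c\<^sub>1 * exp (- c\<^sub>2 * real n)) \<and>
     (\<forall>n\<ge>1. AE \<rho> in run_measure C.
        \<bar>ost_process C \<eta> f (Suc n) \<rho> - ost_process C \<eta> f n \<rho>\<bar> \<le> M * real n powr d))"

definition ost_sound ::
    "('l, 'v) pcfg \<Rightarrow> ('l, 'v) state_fun \<Rightarrow> (('v \<Rightarrow> real) \<Rightarrow> real) \<Rightarrow> bool" where
  "ost_sound C \<eta> f \<longleftrightarrow> (\<forall>i. integrable (run_measure C) (ost_process C \<eta> f i)) \<and>
     (ost_C1 C \<or> ost_C2 C \<eta> f \<or> ost_C3 C \<eta> f \<or> ost_C4 C \<eta> f)"

end

theory Submission
  imports Defs "HOL-Real_Asymp.Real_Asymp"
begin

text \<open>
  Along a run \<open>\<rho>\<close> the process \<open>Y\<^sub>n = \<eta>(S\<^sub>n) + f(x\<^sub>n)\<close> is constant from the termination time on, where it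
  equals \<open>f\<close> of the output, so no stopped process is needed: the expectations \<open>E Y\<^sub>n\<close> decrease for a
  UESM, and OST-soundness provides an integrable bound (a constant in case (C2), and
  \<open>\<bar>Y\<^sub>1\<bar> + \<Sum>\<^sub>n \<bar>Y\<^sub>n\<^sub>+\<^sub>1 - Y\<^sub>n\<bar>\<close> otherwise) that lets \<open>E Y\<^sub>n\<close> converge to the expectation of \<open>f\<close> of the
  output. The LESM case follows by negation.

  The output law of the restarting graph is the NOD of the original graph. Let \<open>p(B)\<close> be the
  probability of an output in \<open>B\<close> after restarting, and \<open>a(B)\<close> the expected weight of the outputs in
  \<open>B\<close> in the original graph, with total mass \<open>a\<close>. Unrolling the first attempt gives
  \<open>p(B) \<ge> a(B)/M + (1 - a/M) p(B)\<close>, hence \<open>p(B) \<ge> a(B)/a\<close>. The same bound for the complement of \<open>B\<close>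
  forces equality and almost-sure termination. Instead of the strong Markov property at restarts, the
  unrolling uses an excessive function of the restarting chain and an induction on the number of
  steps.
\<close>

section \<open>The Markov process of a control-flow graph\<close>

text \<open>Weighted restarting is rejection sampling: an attempt that ends with weight
  \<open>W\<close> is accepted with probability \<open>W / M\<close>, and the bound \<open>M\<close>
  makes this a probability. The number of attempts is random, so computing the output law directly
  would mean conditioning on restart times. An excessive function, whose expected value after one
  step never exceeds its current value, avoids this. A restart resets every variable and so leads to
  one fixed state, hence the same number \<open>H (init_state Res)\<close> stands on both sides of
  an inequality that needs expectations at fixed times only; positivity of the expected weight
  allows solving it. A second obstacle is that runs are defined by a relation, with samples confined
  to topological supports, while expectations refer to a measure on all state sequences. Hence the
  work on measurability of the relation and on runs having full measure, after which termination and
  output can be treated path by path.\<close>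

lemma measurable_PiM_kernel:
  fixes K :: "'i \<Rightarrow> 'a \<Rightarrow> 'b measure"
  assumes I: "finite I" and K: "\<And>i. i \<in> I \<Longrightarrow> K i \<in> M \<rightarrow>\<^sub>M prob_algebra (N i)"
  shows "(\<lambda>x. PiM I (\<lambda>i. K i x)) \<in> M \<rightarrow>\<^sub>M prob_algebra (PiM I N)"
\<comment> \<open>Boxes form an intersection-stable generator, and on a box the product measure is a
  finite product of kernel values, hence measurable in \<open>x\<close>.\<close>
proof (rule measurable_prob_algebra_generated[OF sets_PiM Int_stable_prod_algebra prod_algebra_sets_into_space])
  have prob: "prob_space (K i x)" and sets: "sets (K i x) = sets (N i)" if "i \<in> I" "x \<in> space M" for i x
    using measurable_space[OF K[OF that(1)] that(2)] by (auto simp: space_prob_algebra)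
  fix x assume x: "x \<in> space M"
  show "prob_space (PiM I (\<lambda>i. K i x))"
    by (intro prob_space_PiM prob x)
  show "sets (PiM I (\<lambda>i. K i x)) = sets (PiM I N)"
    by (intro sets_PiM_cong refl sets x)
next
  have prob: "prob_space (K i x)" and sets: "sets (K i x) = sets (N i)" if "i \<in> I" "x \<in> space M" for i x
    using measurable_space[OF K[OF that(1)] that(2)] by (auto simp: space_prob_algebra)
  fix A assume "A \<in> prod_algebra I N"
  then obtain E where A: "A = Pi\<^sub>E I E" and E: "E \<in> (\<Pi> i\<in>I. sets (N i))"
    by (rule prod_algebraE_all)
  have "emeasure (PiM I (\<lambda>i. K i x)) A = (\<Prod>i\<in>I. emeasure (K i x) (E i))" if x: "x \<in> space M" for x
  proof -
    have "prod_emb I (\<lambda>i. K i x) I (Pi\<^sub>E I E) = A"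
      unfolding A using E
      by (intro prod_emb_PiE_same_index sets.sets_into_space) (auto simp: sets x)
    moreover have "emeasure (PiM I (\<lambda>i. K i x)) (prod_emb I (\<lambda>i. K i x) I (Pi\<^sub>E I E)) = (\<Prod>i\<in>I. emeasure (K i x) (E i))"
      using E x I by (intro emeasure_PiM_emb prob) (auto simp: sets)
    ultimately show ?thesis by simp
  qed
  moreover have "(\<lambda>x. \<Prod>i\<in>I. emeasure (K i x) (E i)) \<in> borel_measurable M"
  proof (intro borel_measurable_prod_ennreal)
    fix i assume i: "i \<in> I"
    have "K i \<in> M \<rightarrow>\<^sub>M subprob_algebra (N i)"
      using K[OF i] by (rule measurable_prob_algebraD)
    from emeasure_measurable_subprob_algebra2[OF _ this, of "\<lambda>_. E i"]
    show "(\<lambda>x. emeasure (K i x) (E i)) \<in> borel_measurable M"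
      using measurable_compose[OF \<open>K i \<in> M \<rightarrow>\<^sub>M subprob_algebra (N i)\<close>, OF measurable_emeasure_subprob_algebra] E i by auto
  qed
  ultimately show "(\<lambda>x. emeasure (PiM I (\<lambda>i. K i x)) A) \<in> borel_measurable M"
    by (subst measurable_cong) auto
qed

text \<open>The real line has a countable basis, so the points outside the support are covered by
  countably many null basic open sets.\<close>

lemma AE_in_msupport:
  assumes "real_distribution d"
  shows "AE r in d. r \<in> msupport d"
proof -
  interpret real_distribution d by fact
  obtain B :: "real set set" where B: "countable B" "topological_basis B"
    using ex_countable_basis by auto
  have "AE r in d. \<forall>U\<in>{U\<in>B. emeasure d U = 0}. r \<notin> U"
  proof (subst AE_ball_countable)
    show "countable {U \<in> B. emeasure d U = 0}" using B by auto
    show "\<forall>U\<in>{U \<in> B. emeasure d U = 0}. AE r in d. r \<notin> U"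
      using topological_basis_open[OF B(2)]
      by (auto intro!: AE_not_in simp: null_sets_def)
  qed
  then show ?thesis
  proof eventually_elim
    case (elim r)
    show ?case unfolding msupport_def
    proof (clarify, rule ccontr)
      fix U assume U: "open U" "r \<in> U" "\<not> 0 < emeasure d U"
      from topological_basisE[OF B(2) U(1,2)] obtain B' where B': "B' \<in> B" "r \<in> B'" "B' \<subseteq> U" .
      then have "emeasure d B' \<le> emeasure d U"
        using U by (intro emeasure_mono) auto
      with U(3) B' elim show False by auto
    qed
  qed
qed

text \<open>Closedness makes the support a Borel set, on which the measurability of
  \<open>successor\<close> relies.\<close>

lemma closed_msupport: "closed (msupport d)"
proof -
  have "- msupport d = \<Union>{U. open U \<and> \<not> emeasure d U > 0}"
    by (auto simp: msupport_def)
  then show ?thesis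
    unfolding closed_def by (metis (no_types, lifting) mem_Collect_eq open_Union)
qed

lemma nn_integral_AE_const:
  assumes "prob_space N" and "AE y in N. f y = c"
  shows "(\<integral>\<^sup>+y. f y \<partial>N) = c"
  using nn_integral_cong_AE[OF assms(2)] prob_space.emeasure_space_1[OF assms(1)] by simp

section \<open>The one-step kernel on states\<close>

context wf_pcfg
begin

lemma space_state_space: "space (state_space C) = locs C \<times> space (valuations (vars C))"
  by (simp add: state_space_def space_pair_measure)

lemma countable_locs: "countable (locs C)"
  using finite_locs by (rule countable_finite)

lemma init_state_in: "init_state C \<in> space (state_space C)"
  by (simp add: space_state_space init_loc_in init_val_in)

lemma measurable_fst_state [measurable]: "fst \<in> state_space C \<rightarrow>\<^sub>M count_space (locs C)"
  by (simp add: state_space_def)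

lemma measurable_snd_state [measurable]: "snd \<in> state_space C \<rightarrow>\<^sub>M valuations (vars C)"
  by (simp add: state_space_def)

lemma measurable_Pair_state [measurable]:
  "l \<in> locs C \<Longrightarrow> Pair l \<in> valuations (vars C) \<rightarrow>\<^sub>M state_space C"
  unfolding state_space_def by measurable

lemma measurable_state_spaceI:
  assumes "\<And>l. l \<in> locs C \<Longrightarrow> (\<lambda>x. f (l, x)) \<in> valuations (vars C) \<rightarrow>\<^sub>M N"
  shows "f \<in> state_space C \<rightarrow>\<^sub>M N"
  unfolding state_space_def using countable_locs assms by (rule measurable_pair_measure_countable1)

text \<open>Dispatches on the location of a state that itself depends measurably on the argument;
  two nested uses handle the source and the target of a transition.\<close>

lemma measurable_case_loc:
  assumes "\<And>l. l \<in> locs C \<Longrightarrow> f l \<in> M \<rightarrow>\<^sub>M N" and "g \<in> M \<rightarrow>\<^sub>M state_space C"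
  shows "(\<lambda>x. f (fst (g x)) x) \<in> M \<rightarrow>\<^sub>M N"
  using assms(1) measurable_compose[OF assms(2) measurable_fst_state] countable_locs
  by (rule measurable_compose_countable')

definition next_loc :: "'l \<Rightarrow> ('v \<Rightarrow> real) \<Rightarrow> 'l" where
  "next_loc l x = (THE l'. enabled C l x l')"

lemma enabled_next_loc: "l \<in> locs C \<Longrightarrow> x \<in> space (valuations (vars C)) \<Longrightarrow> enabled C l x (next_loc l x)"
  unfolding next_loc_def by (rule theI') (rule ex1_enabled)

lemma next_loc_eq:
  "l \<in> locs C \<Longrightarrow> x \<in> space (valuations (vars C)) \<Longrightarrow> enabled C l x l' \<Longrightarrow> next_loc l x = l'"
  using enabled_next_loc ex1_enabled by blast

lemma next_loc_trans: "l \<in> locs C \<Longrightarrow> x \<in> space (valuations (vars C)) \<Longrightarrow> (l, next_loc l x) \<in> trans C"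
  using enabled_next_loc by (auto simp: enabled_def)

lemma trans_locs: "(l, l') \<in> trans C \<Longrightarrow> l \<in> locs C" "(l, l') \<in> trans C \<Longrightarrow> l' \<in> locs C"
  using trans_subset by auto

lemma step_eq:
  "step C (l, x) = distr (next_val C (l, next_loc l x) x) (state_space C) (Pair (next_loc l x))"
  by (simp add: step_def next_loc_def Let_def)

text \<open>Since exactly one transition is enabled, the preimage of \<open>l'\<close> is the set
  where the guard of \<open>(l, l')\<close> holds.\<close>

lemma measurable_next_loc:
  assumes l: "l \<in> locs C"
  shows "next_loc l \<in> valuations (vars C) \<rightarrow>\<^sub>M count_space (locs C)"
  unfolding measurable_count_space_eq2[OF finite_locs]
proof (intro conjI ballI)
  show "next_loc l \<in> space (valuations (vars C)) \<rightarrow> locs C"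
    using next_loc_trans[OF l] trans_locs(2) by blast
  fix l' assume "l' \<in> locs C"
  show "next_loc l -` {l'} \<inter> space (valuations (vars C)) \<in> sets (valuations (vars C))"
  proof (cases "(l, l') \<in> trans C")
    case True
    have "next_loc l -` {l'} \<inter> space (valuations (vars C)) = {x\<in>space (valuations (vars C)). guard C (l, l') x}"
      using next_loc_eq[OF l] enabled_next_loc[OF l] True by (auto simp: enabled_def)
    then show ?thesis using guard_measurable[OF True] by (simp add: pred_def)
  next
    case False
    then have "next_loc l -` {l'} \<inter> space (valuations (vars C)) = {}"
      using next_loc_trans[OF l] by auto
    then show ?thesis by simp
  qed
qed

lemma measurable_value_dist:
  assumes "\<tau> \<in> trans C" "v \<in> vars C"
  shows "(\<lambda>x. value_dist (upd C \<tau> v) x v) \<in> valuations (vars C) \<rightarrow>\<^sub>M prob_algebra borel"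
proof (cases "upd C \<tau> v")
  case Keep
  have "(\<lambda>x. return borel (x v)) \<in> valuations (vars C) \<rightarrow>\<^sub>M prob_algebra (borel :: real measure)"
    using assms by (intro measurable_compose[OF _ measurable_return_prob_space]) simp
  then show ?thesis using Keep by simp
next
  case (Det e)
  have "(\<lambda>x. return borel (e x)) \<in> valuations (vars C) \<rightarrow>\<^sub>M prob_algebra (borel :: real measure)"
    using Det_measurable[OF assms Det] by (intro measurable_compose[OF _ measurable_return_prob_space])
  then show ?thesis using Det by simp
next
  case (Sample d)
  interpret real_distribution d by (rule Sample_distribution[OF assms Sample])
  have "d \<in> space (prob_algebra borel)" by (simp add: space_prob_algebra prob_space_axioms)
  then show ?thesis using Sample by simp
qed

lemma measurable_next_val:
  "\<tau> \<in> trans C \<Longrightarrow> next_val C \<tau> \<in> valuations (vars C) \<rightarrow>\<^sub>M prob_algebra (valuations (vars C))"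
  unfolding next_val_def[abs_def] using finite_vars measurable_value_dist
  by (intro measurable_PiM_kernel) auto

lemma
  assumes "\<tau> \<in> trans C" "x \<in> space (valuations (vars C))"
  shows sets_next_val: "sets (next_val C \<tau> x) = sets (valuations (vars C))"
    and space_next_val: "space (next_val C \<tau> x) = space (valuations (vars C))"
    and prob_space_next_val: "prob_space (next_val C \<tau> x)"
proof -
  have *: "sets (next_val C \<tau> x) = sets (valuations (vars C)) \<and> prob_space (next_val C \<tau> x)"
    using measurable_space[OF measurable_next_val[OF assms(1)] assms(2)] by (simp add: space_prob_algebra)
  then show "sets (next_val C \<tau> x) = sets (valuations (vars C))" "prob_space (next_val C \<tau> x)"
    by auto
  from sets_eq_imp_space_eq[OF conjunct1[OF *]]
  show "space (next_val C \<tau> x) = space (valuations (vars C))" .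
qed

lemma
  assumes "\<tau> \<in> trans C" "x \<in> space (valuations (vars C))" "v \<in> vars C"
  shows sets_value_dist: "sets (value_dist (upd C \<tau> v) x v) = sets borel"
    and prob_space_value_dist: "prob_space (value_dist (upd C \<tau> v) x v)"
  using measurable_space[OF measurable_value_dist[OF assms(1,3)] assms(2)]
  by (auto simp: space_prob_algebra)

lemma AE_next_val_component:
  assumes "\<tau> \<in> trans C" "x \<in> space (valuations (vars C))" "v \<in> vars C"
    and "AE r in value_dist (upd C \<tau> v) x v. P r"
  shows "AE y in next_val C \<tau> x. P (y v)"
  unfolding next_val_def using assms prob_space_value_dist by (intro AE_PiM_component) auto

text \<open>\<open>next_val\<close> is a product measure, so the law of one coordinate is its own
  factor; later this evaluates the integral over the uniform variable \<open>u\<close>.\<close>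

lemma nn_integral_next_val_component:
  assumes "\<tau> \<in> trans C" "x \<in> space (valuations (vars C))" "v \<in> vars C"
    and g: "g \<in> borel_measurable borel"
  shows "(\<integral>\<^sup>+y. g (y v) \<partial>next_val C \<tau> x) = (\<integral>\<^sup>+r. g r \<partial>value_dist (upd C \<tau> v) x v)"
proof -
  have "value_dist (upd C \<tau> v) x v = distr (next_val C \<tau> x) (value_dist (upd C \<tau> v) x v) (\<lambda>y. y v)"
    unfolding next_val_def
    using distr_PiM_component[where M="\<lambda>v. value_dist (upd C \<tau> v) x v", OF prob_space_value_dist[OF assms(1,2)] assms(3)] by simp
  moreover have "(\<lambda>y. y v) \<in> next_val C \<tau> x \<rightarrow>\<^sub>M value_dist (upd C \<tau> v) x v"
    unfolding next_val_def by (rule measurable_component_singleton[OF assms(3)])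
  moreover have "g \<in> borel_measurable (value_dist (upd C \<tau> v) x v)"
    using g measurable_cong_sets[OF sets_value_dist[OF assms(1-3)] refl] by blast
  ultimately show ?thesis by (metis nn_integral_distr)
qed

text \<open>Links the law of an update to the relational semantics. For \<open>Keep\<close> and
  \<open>Det\<close> the set of possible values is a singleton, so this also pins down the new value
  of such a variable almost surely.\<close>

lemma AE_next_val_possible:
  assumes "\<tau> \<in> trans C" "x \<in> space (valuations (vars C))"
  shows "AE y in next_val C \<tau> x. \<forall>v\<in>vars C. y v \<in> possible_values (upd C \<tau> v) x v"
  unfolding AE_ball_countable[OF countable_finite[OF finite_vars]]
proof
  fix v assume v: "v \<in> vars C"
  have "AE r in value_dist (upd C \<tau> v) x v. r \<in> possible_values (upd C \<tau> v) x v"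
  proof (cases "upd C \<tau> v")
    case (Sample d)
    show ?thesis
      unfolding Sample value_dist.simps possible_values.simps
      by (rule AE_in_msupport[OF Sample_distribution[OF assms(1) v Sample]])
  qed (simp_all only: value_dist.simps possible_values.simps, simp_all add: AE_return)
  then show "AE y in next_val C \<tau> x. y v \<in> possible_values (upd C \<tau> v) x v"
    by (rule AE_next_val_component[OF assms v])
qed

lemma measurable_step: "step C \<in> state_space C \<rightarrow>\<^sub>M prob_algebra (state_space C)"
proof (rule measurable_state_spaceI)
  fix l assume l: "l \<in> locs C"
  \<comment> \<open>\<open>next_val\<close> is a kernel only along transitions; the point mass at
    the initial state is a filler that does not occur at \<open>l' = next_loc l x\<close>.\<close>
  define F where "F l' x = (if (l, l') \<in> trans C then distr (next_val C (l, l') x) (state_space C) (Pair l')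
    else return (state_space C) (init_state C))" for l' x
  have F: "F l' \<in> valuations (vars C) \<rightarrow>\<^sub>M prob_algebra (state_space C)" if "l' \<in> locs C" for l'
  proof (cases "(l, l') \<in> trans C")
    case True
    then show ?thesis unfolding F_def
      using that by (auto intro!: measurable_distr_prob_space2[OF measurable_next_val[OF True]])
  next
    case False
    have "return (state_space C) (init_state C) \<in> space (prob_algebra (state_space C))"
      using init_state_in by (simp add: space_prob_algebra prob_space_return)
    then show ?thesis using False by (simp add: F_def[abs_def])
  qed
  have "(\<lambda>x. F (next_loc l x) x) \<in> valuations (vars C) \<rightarrow>\<^sub>M prob_algebra (state_space C)"
    by (rule measurable_compose_countable'[OF F measurable_next_loc[OF l] countable_locs])
  also have "(\<lambda>x. F (next_loc l x) x) \<in> valuations (vars C) \<rightarrow>\<^sub>M prob_algebra (state_space C) \<longleftrightarrow>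
     (\<lambda>x. step C (l, x)) \<in> valuations (vars C) \<rightarrow>\<^sub>M prob_algebra (state_space C)"
    using next_loc_trans[OF l] by (intro measurable_cong) (simp add: F_def step_eq)
  finally show "(\<lambda>x. step C (l, x)) \<in> valuations (vars C) \<rightarrow>\<^sub>M prob_algebra (state_space C)" .
qed

lemma measurable_step_subprob [measurable]: "step C \<in> state_space C \<rightarrow>\<^sub>M subprob_algebra (state_space C)"
  by (rule measurable_prob_algebraD[OF measurable_step])

lemma
  assumes "s \<in> space (state_space C)"
  shows sets_step: "sets (step C s) = sets (state_space C)"
    and space_step: "space (step C s) = space (state_space C)"
    and prob_space_step: "prob_space (step C s)"
proof -
  have *: "sets (step C s) = sets (state_space C) \<and> prob_space (step C s)"
    using measurable_space[OF measurable_step assms] by (simp add: space_prob_algebra)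
  then show "sets (step C s) = sets (state_space C)" "prob_space (step C s)"
    by auto
  from sets_eq_imp_space_eq[OF conjunct1[OF *]]
  show "space (step C s) = space (state_space C)" .
qed

lemma nn_integral_step:
  assumes "l \<in> locs C" "x \<in> space (valuations (vars C))" "enabled C l x l'"
    and f: "f \<in> borel_measurable (state_space C)"
  shows "(\<integral>\<^sup>+s. f s \<partial>step C (l, x)) = (\<integral>\<^sup>+y. f (l', y) \<partial>next_val C (l, l') x)"
proof -
  have t: "(l, l') \<in> trans C" using assms by (simp add: enabled_def)
  have "Pair l' \<in> next_val C (l, l') x \<rightarrow>\<^sub>M state_space C"
    using measurable_Pair_state[OF trans_locs(2)[OF t]]
      measurable_cong_sets[OF sets_next_val[OF t assms(2)] refl] by blast
  then show ?thesis
    using f by (simp add: step_eq next_loc_eq[OF assms(1-3)] nn_integral_distr)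
qed

section \<open>The path measure and its Markov property\<close>

lemma Ionescu_Tulcea_history_kernel: "Ionescu_Tulcea (history_kernel C) (\<lambda>_. state_space C)"
proof (rule Ionescu_Tulcea.intro)
  fix i
  have "step C \<circ> (\<lambda>\<omega>. \<omega> j) \<in> PiM {0..<Suc j} (\<lambda>_. state_space C) \<rightarrow>\<^sub>M prob_algebra (state_space C)" for j
    using measurable_step by (intro measurable_comp) auto
  moreover have "return (state_space C) (init_state C) \<in> space (prob_algebra (state_space C))"
    using init_state_in by (simp add: space_prob_algebra prob_space_return)
  ultimately have *: "history_kernel C i \<in> PiM {0..<i} (\<lambda>_. state_space C) \<rightarrow>\<^sub>M prob_algebra (state_space C)"
    by (cases i) (auto simp: history_kernel_def[abs_def] comp_def)
  show "history_kernel C i \<in> PiM {0..<i} (\<lambda>_. state_space C) \<rightarrow>\<^sub>M subprob_algebra (state_space C)"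
    by (rule measurable_prob_algebraD[OF *])
  show "prob_space (history_kernel C i x)" if "x \<in> space (PiM {0..<i} (\<lambda>_. state_space C))" for x
    using measurable_space[OF * that] by (simp add: space_prob_algebra)
qed

sublocale IT: Ionescu_Tulcea "history_kernel C" "\<lambda>_. state_space C"
  by (rule Ionescu_Tulcea_history_kernel)

lemma run_measure_eq: "run_measure C = IT.PF.lim"
  by (simp add: run_measure_def)

lemma sets_run_measure [measurable_cong, simp]: "sets (run_measure C) = sets (PiM UNIV (\<lambda>_. state_space C))"
  by (simp add: run_measure_eq)

lemma space_run_measure: "space (run_measure C) = UNIV \<rightarrow>\<^sub>E space (state_space C)"
  by (simp add: run_measure_eq space_PiM)

lemma measurable_run_component [measurable]: "(\<lambda>\<rho>. \<rho> n) \<in> run_measure C \<rightarrow>\<^sub>M state_space C"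
  using measurable_cong_sets[OF sets_run_measure refl] measurable_component_singleton[of n UNIV] by blast

lemma measurable_run_restrict [measurable]:
  "(\<lambda>\<rho>. restrict \<rho> J) \<in> run_measure C \<rightarrow>\<^sub>M PiM J (\<lambda>_. state_space C)"
  by (intro measurable_restrict) simp

lemma nn_integral_run_restrict:
  assumes [measurable]: "f \<in> borel_measurable (PiM {0..<n} (\<lambda>_. state_space C))"
  shows "(\<integral>\<^sup>+\<rho>. f (restrict \<rho> {0..<n}) \<partial>run_measure C) = (\<integral>\<^sup>+\<rho>. f \<rho> \<partial>IT.C 0 n (\<lambda>_. undefined))"
proof -
  \<comment> \<open>\<open>IT.CI J\<close> is the law of the coordinates below the least bound
    \<open>up_to J\<close>, cut down to \<open>J\<close>; for an initial segment this bound is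
    \<open>n\<close> and nothing is cut.\<close>
  have up: "IT.up_to {0..<n} = n"
    using IT.up_to_iff[of "{0..<n}" n] IT.up_to_less[of "{0..<n}" "IT.up_to {0..<n}"] by force
  have *: "IT.CI {0..<n} = IT.C 0 n (\<lambda>_. undefined)"
    using IT.distr_C[of n n "\<lambda>_. undefined" 0] by (simp add: IT.CI_def up)
  have "(\<integral>\<^sup>+\<rho>. f (restrict \<rho> {0..<n}) \<partial>run_measure C) =
      (\<integral>\<^sup>+\<rho>. f \<rho> \<partial>distr (run_measure C) (PiM {0..<n} (\<lambda>_. state_space C)) (\<lambda>\<rho>. restrict \<rho> {0..<n}))"
    by (subst nn_integral_distr) auto
  also have "distr (run_measure C) (PiM {0..<n} (\<lambda>_. state_space C)) (\<lambda>\<rho>. restrict \<rho> {0..<n}) = IT.CI {0..<n}"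
    unfolding run_measure_eq by (rule IT.distr_lim) simp
  finally show ?thesis by (simp add: * del: restrict_apply)
qed

sublocale prob_space "run_measure C"
proof
  have "(\<integral>\<^sup>+\<rho>. 1 \<partial>run_measure C) = (\<integral>\<^sup>+\<rho>. 1 \<partial>IT.C 0 0 (\<lambda>_. undefined))"
    using nn_integral_run_restrict[of "\<lambda>_. 1" 0] by simp
  then show "emeasure (run_measure C) (space (run_measure C)) = 1"
    using prob_space.emeasure_space_1[OF IT.prob_space_C[of "\<lambda>_. undefined" 0 0]] by simp
qed

lemma nn_integral_run_Suc:
  assumes f[measurable]: "f \<in> borel_measurable (PiM {0..<Suc n} (\<lambda>_. state_space C))"
  shows "(\<integral>\<^sup>+\<rho>. f (restrict \<rho> {0..<Suc n}) \<partial>run_measure C) =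
    (\<integral>\<^sup>+\<rho>. \<integral>\<^sup>+s. f ((restrict \<rho> {0..<n})(n := s)) \<partial>history_kernel C n (restrict \<rho> {0..<n}) \<partial>run_measure C)"
proof -
  have "(\<integral>\<^sup>+\<rho>. f (restrict \<rho> {0..<Suc n}) \<partial>run_measure C) =
     (\<integral>\<^sup>+\<rho>. \<integral>\<^sup>+s. f s \<partial>IT.eP n \<rho> \<partial>IT.C 0 n (\<lambda>_. undefined))"
  proof -
    have "IT.eP n \<in> IT.C 0 n (\<lambda>_. undefined) \<rightarrow>\<^sub>M subprob_algebra (PiM {0..<Suc n} (\<lambda>_. state_space C))"
      unfolding measurable_cong_sets[OF IT.sets_C[of "\<lambda>_. undefined" 0 n, simplified] refl]
      by (rule IT.measurable_eP)
    from nn_integral_bind[OF f this] show ?thesis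
      unfolding nn_integral_run_restrict[OF f] IT.C.simps add_0 .
  qed
  also have "\<dots> = (\<integral>\<^sup>+\<rho>. \<integral>\<^sup>+s. f s \<partial>IT.eP n (restrict \<rho> {0..<n}) \<partial>run_measure C)"
    by (rule nn_integral_run_restrict[symmetric],
        rule measurable_compose[OF IT.measurable_eP nn_integral_measurable_subprob_algebra[OF f]])
  also have "\<dots> = (\<integral>\<^sup>+\<rho>. \<integral>\<^sup>+s. f ((restrict \<rho> {0..<n})(n := s)) \<partial>history_kernel C n (restrict \<rho> {0..<n}) \<partial>run_measure C)"
    by (rule nn_integral_cong, rule IT.nn_integral_eP[OF measurable_space[OF measurable_run_restrict] f])
  finally show ?thesis .
qed

text \<open>A singleton of valuations is a box of singletons, measurable because
  \<open>vars C\<close> is finite.\<close>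

lemma singleton_init_state: "{init_state C} \<in> sets (state_space C)"
proof -
  have "{init_val C} = (\<Pi>\<^sub>E v\<in>vars C. {init_val C v})"
    using init_val_in by (force simp: space_PiM PiE_iff extensional_def fun_eq_iff)
  also have "\<dots> \<in> sets (valuations (vars C))"
    using finite_vars by (intro sets_PiM_I_finite) auto
  finally have "{init_loc C} \<times> {init_val C} \<in> sets (state_space C)"
    unfolding state_space_def using init_loc_in by (intro pair_measureI) auto
  then show ?thesis by simp
qed

lemma AE_run_init: "AE \<rho> in run_measure C. \<rho> 0 = init_state C"
proof -
  have [measurable]: "Measurable.pred (state_space C) (\<lambda>s. s \<noteq> init_state C)"
  proof -
    have "{s \<in> space (state_space C). s \<noteq> init_state C} = space (state_space C) - {init_state C}" by auto
    then show ?thesis using singleton_init_state by (simp add: pred_def)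
  qed
  have "(\<integral>\<^sup>+\<rho>. indicator {s. s \<noteq> init_state C} (\<rho> 0) \<partial>run_measure C) =
     (\<integral>\<^sup>+\<rho>. \<integral>\<^sup>+s. indicator {s. s \<noteq> init_state C} s \<partial>return (state_space C) (init_state C) \<partial>run_measure C)"
    using nn_integral_run_Suc[of "\<lambda>\<rho>. indicator {s. s \<noteq> init_state C} (\<rho> 0)" 0] by (simp add: history_kernel_def)
  also have "\<dots> = 0"
    by (simp add: nn_integral_return init_state_in)
  finally have "AE \<rho> in run_measure C. indicator {s. s \<noteq> init_state C} (\<rho> 0) = (0::ennreal)"
    by (subst (asm) nn_integral_0_iff_AE) auto
  then show ?thesis by eventually_elim (auto split: split_indicator_asm)
qed

text \<open>\<open>h\<close> is an arbitrary statistic of the history up to time \<open>n\<close>,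
  so that the weight collected so far can be carried along with the current state.\<close>

theorem markov_property:
  assumes f[measurable]: "f \<in> borel_measurable (N \<Otimes>\<^sub>M state_space C)"
    and h: "h \<in> PiM {..n} (\<lambda>_. state_space C) \<rightarrow>\<^sub>M N"
  shows "(\<integral>\<^sup>+\<rho>. f (h (restrict \<rho> {..n}), \<rho> (Suc n)) \<partial>run_measure C) =
    (\<integral>\<^sup>+\<rho>. \<integral>\<^sup>+s. f (h (restrict \<rho> {..n}), s) \<partial>step C (\<rho> n) \<partial>run_measure C)"
proof -
  have I: "{0..<Suc n} = {..n}" by auto
  have [measurable]: "(\<lambda>\<rho>. h (restrict \<rho> {..n})) \<in> PiM {0..<Suc (Suc n)} (\<lambda>_. state_space C) \<rightarrow>\<^sub>M N"
    by (intro measurable_compose[OF _ h] measurable_restrict) auto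
  have *: "restrict (restrict \<rho> {0..<Suc (Suc n)}) {..n} = restrict \<rho> {..n}"
     "restrict ((restrict \<rho> {..n})(Suc n := s)) {..n} = restrict \<rho> {..n}" for \<rho> :: "nat \<Rightarrow> ('l, 'v) state" and s
    by (auto simp: fun_eq_iff)
  have m: "(\<lambda>\<rho>. f (h (restrict \<rho> {..n}), \<rho> (Suc n))) \<in> borel_measurable (PiM {0..<Suc (Suc n)} (\<lambda>_. state_space C))"
    by measurable
  have "(\<integral>\<^sup>+\<rho>. f (h (restrict \<rho> {..n}), \<rho> (Suc n)) \<partial>run_measure C) =
    (\<integral>\<^sup>+\<rho>. (\<lambda>\<rho>. f (h (restrict \<rho> {..n}), \<rho> (Suc n))) (restrict \<rho> {0..<Suc (Suc n)}) \<partial>run_measure C)"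
    by (simp only: *) simp
  also have "\<dots> = (\<integral>\<^sup>+\<rho>. \<integral>\<^sup>+s. f (h (restrict \<rho> {..n}), s) \<partial>step C (\<rho> n) \<partial>run_measure C)"
    by (subst nn_integral_run_Suc[OF m]) (simp only: I * , simp add: history_kernel_def)
  finally show ?thesis .
qed

lemma markov_pair:
  assumes f[measurable]: "f \<in> borel_measurable (state_space C \<Otimes>\<^sub>M state_space C)"
  shows "(\<integral>\<^sup>+\<rho>. f (\<rho> n, \<rho> (Suc n)) \<partial>run_measure C) =
    (\<integral>\<^sup>+\<rho>. \<integral>\<^sup>+s. f (\<rho> n, s) \<partial>step C (\<rho> n) \<partial>run_measure C)"
  using markov_property[OF f, of "\<lambda>\<rho>. \<rho> n" n] by simp

lemma markov_single:
  assumes f[measurable]: "f \<in> borel_measurable (state_space C)"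
  shows "(\<integral>\<^sup>+\<rho>. f (\<rho> (Suc n)) \<partial>run_measure C) = (\<integral>\<^sup>+\<rho>. \<integral>\<^sup>+s. f s \<partial>step C (\<rho> n) \<partial>run_measure C)"
  using markov_pair[of "\<lambda>p. f (snd p)" n] by simp

lemma run_in_space: "\<rho> \<in> space (run_measure C) \<Longrightarrow> \<rho> n \<in> space (state_space C)"
  by (auto simp: space_run_measure)

text \<open>By the Markov property the probability of failure at time \<open>n\<close> is the mean
  of one-step failure probabilities, all of which are 0.\<close>

lemma AE_markov_pair:
  assumes P[measurable]: "Measurable.pred (state_space C \<Otimes>\<^sub>M state_space C) P"
    and AE: "\<And>s. s \<in> space (state_space C) \<Longrightarrow> AE s' in step C s. P (s, s')"
  shows "AE \<rho> in run_measure C. P (\<rho> n, \<rho> (Suc n))"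
proof -
  have [measurable]: "Collect P \<inter> space (state_space C \<Otimes>\<^sub>M state_space C) \<in> sets (state_space C \<Otimes>\<^sub>M state_space C)"
    using P by (simp add: pred_def Int_def conj_commute)
  define f :: "('l, 'v) state \<times> ('l, 'v) state \<Rightarrow> ennreal" where "f p = of_bool (\<not> P p)" for p
  have [measurable]: "f \<in> borel_measurable (state_space C \<Otimes>\<^sub>M state_space C)"
    unfolding f_def by measurable
  have "(\<integral>\<^sup>+\<rho>. f (\<rho> n, \<rho> (Suc n)) \<partial>run_measure C) = (\<integral>\<^sup>+\<rho>. \<integral>\<^sup>+s. f (\<rho> n, s) \<partial>step C (\<rho> n) \<partial>run_measure C)"
    by (rule markov_pair) measurable
  also have "\<dots> = (\<integral>\<^sup>+\<rho>. 0 \<partial>run_measure C)"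
  proof (rule nn_integral_cong)
    fix \<rho> assume "\<rho> \<in> space (run_measure C)"
    then have s: "\<rho> n \<in> space (state_space C)" by (rule run_in_space)
    have "AE s' in step C (\<rho> n). f (\<rho> n, s') = 0"
      using AE[OF s] by eventually_elim (simp add: f_def)
    then show "(\<integral>\<^sup>+s. f (\<rho> n, s) \<partial>step C (\<rho> n)) = 0"
      by (rule nn_integral_AE_const[OF prob_space_step[OF s]])
  qed
  finally have "AE \<rho> in run_measure C. f (\<rho> n, \<rho> (Suc n)) = 0"
    by (simp add: nn_integral_0_iff_AE)
  then show ?thesis by eventually_elim (simp add: f_def split: if_splits)
qed

section \<open>Runs have full measure\<close>

lemma measurable_possible_values:
  assumes \<tau>: "\<tau> \<in> trans C" and v: "v \<in> vars C"
    and [measurable]: "g \<in> M \<rightarrow>\<^sub>M valuations (vars C)" "h \<in> M \<rightarrow>\<^sub>M valuations (vars C)"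
  shows "Measurable.pred M (\<lambda>p. h p v \<in> possible_values (upd C \<tau> v) (g p) v)"
proof -
  have [measurable]: "(\<lambda>p. g p v) \<in> borel_measurable M" "(\<lambda>p. h p v) \<in> borel_measurable M"
    using v by (auto intro!: measurable_component_singleton' [of _ _ "vars C" "\<lambda>_. borel" "\<lambda>x. x"])
  show ?thesis
  proof (cases "upd C \<tau> v")
    case Keep
    then show ?thesis by simp
  next
    case (Det e)
    have [measurable]: "(\<lambda>p. e (g p)) \<in> borel_measurable M"
      using Det_measurable[OF \<tau> v Det] by measurable
    show ?thesis using Det by simp
  next
    case (Sample d)
    have [measurable]: "msupport d \<in> sets borel"
      using closed_msupport by (rule borel_closed)
    show ?thesis using Sample by simp
  qed
qed

text \<open>For a fixed pair of locations the relation is a guard together with one condition per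
  variable, and there are only finitely many locations and variables.\<close>

lemma measurable_successor [measurable]:
  "Measurable.pred (state_space C \<Otimes>\<^sub>M state_space C) (\<lambda>p. successor C (fst p) (snd p))"
proof -
  let ?M = "state_space C \<Otimes>\<^sub>M state_space C"
  define F where "F l l' p \<longleftrightarrow> (l, l') \<in> trans C \<and> guard C (l, l') (snd (fst p)) \<and>
    (\<forall>v\<in>vars C. snd (snd p) v \<in> possible_values (upd C (l, l') v) (snd (fst p)) v)"
    for l l' and p :: "('l, 'v) state \<times> ('l, 'v) state"
  have F: "F l l' \<in> ?M \<rightarrow>\<^sub>M count_space UNIV" for l l'
  proof (cases "(l, l') \<in> trans C")
    case True
    have "Measurable.pred ?M (\<lambda>p. \<forall>v\<in>vars C. snd (snd p) v \<in> possible_values (upd C (l, l') v) (snd (fst p)) v)"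
      using finite_vars by (intro pred_intros_finite measurable_possible_values[OF True]) auto
    moreover have "Measurable.pred ?M (\<lambda>p. guard C (l, l') (snd (fst p)))"
      by (rule measurable_compose[OF _ guard_measurable[OF True]]) simp
    ultimately show ?thesis using True unfolding F_def[abs_def] by simp
  qed (simp add: F_def[abs_def])
  have "(\<lambda>p. F (fst (fst p)) (fst (snd p)) p) \<in> ?M \<rightarrow>\<^sub>M count_space UNIV"
    by (rule measurable_case_loc[OF _ measurable_fst], rule measurable_case_loc[OF _ measurable_snd], rule F)
  also have "?this \<longleftrightarrow> ?thesis"
    by (rule measurable_cong)
       (auto simp: F_def successor_def enabled_def space_pair_measure space_state_space split: prod.splits)
  finally show ?thesis .
qed

lemma AE_step_successor:
  assumes "s \<in> space (state_space C)"
  shows "AE s' in step C s. successor C s s'"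
proof -
  obtain l x where s: "s = (l, x)" by (cases s)
  with assms have l: "l \<in> locs C" and x: "x \<in> space (valuations (vars C))"
    by (auto simp: space_state_space)
  define l' where "l' = next_loc l x"
  have en: "enabled C l x l'" and t: "(l, l') \<in> trans C"
    using enabled_next_loc[OF l x] next_loc_trans[OF l x] by (auto simp: l'_def)
  have P: "Pair l' \<in> next_val C (l, l') x \<rightarrow>\<^sub>M state_space C"
    using measurable_Pair_state[OF trans_locs(2)[OF t]]
      measurable_cong_sets[OF sets_next_val[OF t x] refl] by blast
  have m: "{s' \<in> space (state_space C). successor C s s'} \<in> sets (state_space C)"
  proof -
    have "Measurable.pred (state_space C) (\<lambda>s'. (\<lambda>p. successor C (fst p) (snd p)) (s, s'))"
      by (rule measurable_compose[OF _ measurable_successor]) (use assms in simp)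
    then show ?thesis by (simp add: pred_def)
  qed
  have "AE y in next_val C (l, l') x. successor C s (l', y)"
    using AE_next_val_possible[OF t x] AE_space
    by eventually_elim (use x en in \<open>auto simp: s successor_def space_next_val[OF t x]\<close>)
  then show ?thesis
    unfolding s step_eq l'_def[symmetric]
    using AE_distr_iff[OF P m] by (simp add: s)
qed

text \<open>A countable intersection of one-step events of probability 1. From here on, facts about
  runs transfer to almost every sequence of states.\<close>

lemma AE_runs: "AE \<rho> in run_measure C. \<rho> \<in> runs C"
proof -
  have "AE \<rho> in run_measure C. \<forall>n. successor C (\<rho> n) (\<rho> (Suc n))"
    unfolding AE_all_countable
    using AE_markov_pair[OF measurable_successor] AE_step_successor by simp
  with AE_run_init show ?thesis by eventually_elim (simp add: runs_def)
qed

lemma measurable_runs [measurable]: "Measurable.pred (run_measure C) (\<lambda>\<rho>. \<rho> \<in> runs C)"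
proof -
  have 1: "Measurable.pred (run_measure C) (\<lambda>\<rho>. \<rho> 0 \<in> {init_state C})"
    using singleton_init_state by (intro pred_sets2[OF _ measurable_run_component])
  have 2: "Measurable.pred (run_measure C) (\<lambda>\<rho>. successor C (\<rho> i) (\<rho> (Suc i)))" for i
  proof -
    have "Measurable.pred (run_measure C) (\<lambda>\<rho>. (\<lambda>p. successor C (fst p) (snd p)) (\<rho> i, \<rho> (Suc i)))"
      by (rule measurable_compose[OF _ measurable_successor]) simp
    then show ?thesis by simp
  qed
  show ?thesis
    unfolding runs_def mem_Collect_eq using 1 2 by (intro pred_intros_logic pred_intros_countable) auto
qed

text \<open>Every state of a run is the source of an enabled transition, so its location is in
  \<open>locs C\<close>.\<close>

lemma runs_subset_space: "runs C \<subseteq> space (run_measure C)"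
proof
  fix \<rho> assume "\<rho> \<in> runs C"
  then have "successor C (\<rho> n) (\<rho> (Suc n))" for n by (simp add: runs_def)
  moreover have "s \<in> space (state_space C)" if "successor C s s'" for s s'
    using that trans_locs(1) by (cases s; cases s') (auto simp: successor_def space_state_space enabled_def)
  ultimately have "\<rho> n \<in> space (state_space C)" for n by blast
  then show "\<rho> \<in> space (run_measure C)" by (auto simp: space_run_measure)
qed

lemma runs_reachable: "\<rho> \<in> runs C \<Longrightarrow> reachable C (\<rho> n)"
proof (induction n)
  case (Suc n)
  then show ?case
    unfolding reachable_def runs_def by (auto intro: rtranclp.rtrancl_into_rtrancl[of _ _ "\<rho> n"])
qed (simp add: runs_def reachable_def)

section \<open>Absorption at the terminal location and the output of a run\<close>

lemma successor_term_loc: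
  assumes "successor C s s'" "fst s = term_loc C"
  shows "s' = s"
proof -
  obtain x l' x' where s: "s = (term_loc C, x)" "s' = (l', x')" using assms(2) by (metis prod.collapse)
  then have *: "x \<in> space (valuations (vars C))" "x' \<in> space (valuations (vars C))" "(term_loc C, l') \<in> trans C"
      "\<And>v. v \<in> vars C \<Longrightarrow> x' v \<in> possible_values (upd C (term_loc C, l') v) x v"
    using assms(1) by (auto simp: successor_def enabled_def)
  then have l': "l' = term_loc C" by (intro term_loop)
  then have "x' v = x v" if "v \<in> vars C" for v
    using *(4)[OF that] term_upd[OF that] by simp
  \<comment> \<open>Valuations are extensional, so agreement on \<open>vars C\<close> is
    equality.\<close>
  then have "x' = x"
    using *(1,2) PiE_ext[of x' "vars C" "\<lambda>_. UNIV" x] by (simp add: space_PiM)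
  with s l' show ?thesis by simp
qed

lemma successor_run: "\<rho> \<in> runs C \<Longrightarrow> successor C (\<rho> i) (\<rho> (Suc i))"
  by (simp add: runs_def)

lemma runs_stay:
  assumes "\<rho> \<in> runs C" "fst (\<rho> n) = term_loc C" "n \<le> m"
  shows "\<rho> m = \<rho> n"
  using assms(3)
proof (induction rule: dec_induct)
  case (step i)
  then show ?case using successor_term_loc[OF successor_run[OF assms(1)], of i] assms(2) by simp
qed simp

text \<open>By absorption, having terminated by time \<open>n\<close> can be read off the state at
  time \<open>n\<close> alone.\<close>

lemma term_time_le_iff:
  assumes "\<rho> \<in> runs C"
  shows "term_time C \<rho> \<le> enat n \<longleftrightarrow> fst (\<rho> n) = term_loc C"
proof
  assume "fst (\<rho> n) = term_loc C"
  then show "term_time C \<rho> \<le> enat n"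
    by (auto simp: term_time_def intro: Least_le)
next
  assume a: "term_time C \<rho> \<le> enat n"
  then have ex: "\<exists>i. fst (\<rho> i) = term_loc C"
    by (auto simp: term_time_def split: if_splits)
  define t where "t = (LEAST i. fst (\<rho> i) = term_loc C)"
  have "fst (\<rho> t) = term_loc C" unfolding t_def using LeastI_ex[OF ex] .
  moreover have "t \<le> n" using a ex by (simp add: term_time_def t_def)
  ultimately show "fst (\<rho> n) = term_loc C"
    using runs_stay[OF assms, of t n] by simp
qed

lemma term_time_finite_iff: "term_time C \<rho> < \<infinity> \<longleftrightarrow> (\<exists>i. fst (\<rho> i) = term_loc C)"
  by (simp add: term_time_def)

lemma measurable_at_term_loc [measurable]:
  "Measurable.pred (run_measure C) (\<lambda>\<rho>. fst (\<rho> n) = term_loc C)"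
proof -
  have "Measurable.pred (run_measure C) (\<lambda>\<rho>. fst (\<rho> n) \<in> {term_loc C})"
    using term_loc_in by (intro pred_sets2[OF _ measurable_compose[OF measurable_run_component measurable_fst_state]]) auto
  then show ?thesis by simp
qed

text \<open>On a sequence that never terminates, \<open>LEAST\<close> denotes an unspecified index.
  Such sequences are null wherever the output is integrated, and a total function remains
  measurable.\<close>

definition out_val :: "(nat \<Rightarrow> ('l, 'v) state) \<Rightarrow> 'v \<Rightarrow> real" where
  "out_val \<rho> = restrict (snd (\<rho> (LEAST i. fst (\<rho> i) = term_loc C))) (outs C)"

lemma measurable_restrict_outs [measurable]:
  "(\<lambda>x. restrict x (outs C)) \<in> valuations (vars C) \<rightarrow>\<^sub>M valuations (outs C)"
  using outs_subset by (rule measurable_restrict_subset)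

lemma measurable_out_val [measurable]: "out_val \<in> run_measure C \<rightarrow>\<^sub>M valuations (outs C)"
proof -
  have "(\<lambda>\<rho>. restrict (snd (\<rho> i)) (outs C)) \<in> run_measure C \<rightarrow>\<^sub>M valuations (outs C)" for i
    by (rule measurable_compose[OF _ measurable_restrict_outs]) simp
  then show ?thesis
    unfolding out_val_def[abs_def] by (rule measurable_compose_countable) measurable
qed

lemma out_val_eq:
  assumes "\<rho> \<in> runs C" "fst (\<rho> n) = term_loc C"
  shows "out_val \<rho> = restrict (snd (\<rho> n)) (outs C)"
proof -
  let ?P = "\<lambda>i. fst (\<rho> i) = term_loc C"
  show ?thesis
    unfolding out_val_def using runs_stay[OF assms(1) LeastI[of ?P n] Least_le[of ?P n]] assms(2) by simp
qed

lemma output_runs_eq: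
  "output_runs C B = {\<rho>\<in>runs C. (\<exists>i. fst (\<rho> i) = term_loc C) \<and> out_val \<rho> \<in> B}"
proof -
  have "(\<exists>i x. \<rho> i = (term_loc C, x) \<and> restrict x (outs C) \<in> B) \<longleftrightarrow>
      (\<exists>i. fst (\<rho> i) = term_loc C) \<and> out_val \<rho> \<in> B" if \<rho>: "\<rho> \<in> runs C" for \<rho>
  proof -
    have "(\<exists>x. \<rho> i = (term_loc C, x) \<and> restrict x (outs C) \<in> B) \<longleftrightarrow>
        fst (\<rho> i) = term_loc C \<and> out_val \<rho> \<in> B" for i
      using out_val_eq[OF \<rho>, of i] by (cases "\<rho> i") auto
    then show ?thesis by simp
  qed
  then show ?thesis unfolding output_runs_def by blast
qed

lemma measurable_output_runs [measurable]:
  assumes [measurable]: "B \<in> sets (valuations (outs C))"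
  shows "output_runs C B \<in> sets (run_measure C)"
proof -
  have "output_runs C B = {\<rho>\<in>space (run_measure C). \<rho> \<in> runs C \<and> (\<exists>i. fst (\<rho> i) = term_loc C) \<and> out_val \<rho> \<in> B}"
    using runs_subset_space by (auto simp: output_runs_eq)
  also have "\<dots> \<in> sets (run_measure C)" by measurable
  finally show ?thesis .
qed

section \<open>Accumulated weights\<close>

text \<open>
  Off the transitions \<^term>\<open>wt C\<close> need not be measurable; the value 0 there makes \<open>wgt\<close> jointly
  measurable.
\<close>

definition wgt :: "('l, 'v) state \<Rightarrow> ('l, 'v) state \<Rightarrow> real" where
  "wgt s s' = (if (fst s, fst s') \<in> trans C then wt C (fst s, fst s') (snd s) else 0)"

lemma wgt_nonneg: "s \<in> space (state_space C) \<Longrightarrow> 0 \<le> wgt s s'"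
  by (auto simp: wgt_def space_state_space wt_nonneg)

lemma measurable_wgt [measurable]:
  "(\<lambda>p. wgt (fst p) (snd p)) \<in> borel_measurable (state_space C \<Otimes>\<^sub>M state_space C)"
proof -
  let ?M = "state_space C \<Otimes>\<^sub>M state_space C"
  define F where "F l l' p = (if (l, l') \<in> trans C then wt C (l, l') (snd (fst p)) else 0)"
    for l l' and p :: "('l, 'v) state \<times> ('l, 'v) state"
  have F: "F l l' \<in> borel_measurable ?M" for l l'
  proof (cases "(l, l') \<in> trans C")
    case True
    have "(\<lambda>p. wt C (l, l') (snd (fst p))) \<in> borel_measurable ?M"
      by (rule measurable_compose[OF _ wt_measurable[OF True]]) simp
    then show ?thesis using True unfolding F_def[abs_def] by simp
  qed (simp add: F_def[abs_def])
  have "(\<lambda>p. F (fst (fst p)) (fst (snd p)) p) \<in> borel_measurable ?M"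
    by (rule measurable_case_loc[OF _ measurable_fst], rule measurable_case_loc[OF _ measurable_snd], rule F)
  then show ?thesis by (simp add: F_def wgt_def[abs_def])
qed

lemma measurable_wgt' [measurable (raw)]:
  assumes "f \<in> M \<rightarrow>\<^sub>M state_space C" "g \<in> M \<rightarrow>\<^sub>M state_space C"
  shows "(\<lambda>x. wgt (f x) (g x)) \<in> borel_measurable M"
  using measurable_compose[OF measurable_Pair[OF assms] measurable_wgt] by simp

text \<open>Unlike \<open>cum_weight\<close>, this is defined at every time and depends on finitely
  many states, so it can serve as a second component of the Markov chain.\<close>

definition acc_weight :: "nat \<Rightarrow> (nat \<Rightarrow> ('l, 'v) state) \<Rightarrow> real" where
  "acc_weight n \<rho> = (\<Prod>i<n. wgt (\<rho> i) (\<rho> (Suc i)))"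

lemma measurable_acc_weight [measurable]: "acc_weight n \<in> borel_measurable (run_measure C)"
  unfolding acc_weight_def[abs_def] by measurable

text \<open>The steps after termination are self-loops of weight 1, so the product stops
  changing.\<close>

lemma acc_weight_eq_cum_weight:
  assumes \<rho>: "\<rho> \<in> runs C" and n: "fst (\<rho> n) = term_loc C"
  shows "acc_weight n \<rho> = cum_weight C \<rho>"
proof -
  define t where "t = (LEAST i. fst (\<rho> i) = term_loc C)"
  have ex: "\<exists>i. fst (\<rho> i) = term_loc C" using n by auto
  have t: "fst (\<rho> t) = term_loc C" unfolding t_def using LeastI_ex[OF ex] .
  have tn: "t \<le> n" unfolding t_def using n by (rule Least_le)
  have w: "wgt (\<rho> i) (\<rho> (Suc i)) = wt C (fst (\<rho> i), fst (\<rho> (Suc i))) (snd (\<rho> i))" for i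
    using successor_run[OF \<rho>, of i] by (auto simp: successor_def enabled_def wgt_def split: prod.splits)
  have "cum_weight C \<rho> = (\<Prod>i<t. wgt (\<rho> i) (\<rho> (Suc i)))"
    using \<rho> ex by (simp add: cum_weight_def term_time_def t_def w)
  also have "\<dots> = (\<Prod>i<n. wgt (\<rho> i) (\<rho> (Suc i)))"
  proof (rule prod.mono_neutral_left)
    show "\<forall>i\<in>{..<n} - {..<t}. wgt (\<rho> i) (\<rho> (Suc i)) = 1"
    proof
      fix i assume "i \<in> {..<n} - {..<t}"
      then have "\<rho> i = \<rho> t" "\<rho> (Suc i) = \<rho> t" using runs_stay[OF \<rho> t, of i] runs_stay[OF \<rho> t, of "Suc i"] by auto
      moreover have "snd (\<rho> t) \<in> space (valuations (vars C))"
        using run_in_space[of \<rho> t] runs_subset_space \<rho> by (auto simp: space_state_space mem_Times_iff)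
      ultimately show "wgt (\<rho> i) (\<rho> (Suc i)) = 1"
        using w[of i] by (simp add: t term_wt)
    qed
  qed (use tn in auto)
  finally show ?thesis unfolding acc_weight_def by (rule sym)
qed

text \<open>The transition operator of the chain formed by the state and the weight collected so
  far.\<close>

definition weighted_step ::
    "(('l, 'v) state \<times> real \<Rightarrow> ennreal) \<Rightarrow> ('l, 'v) state \<times> real \<Rightarrow> ennreal" where
  "weighted_step \<phi> = (\<lambda>(s, c). \<integral>\<^sup>+s'. \<phi> (s', c * wgt s s') \<partial>step C s)"

lemma measurable_weighted_step:
  assumes [measurable]: "\<phi> \<in> borel_measurable (state_space C \<Otimes>\<^sub>M borel)"
  shows "weighted_step \<phi> \<in> borel_measurable (state_space C \<Otimes>\<^sub>M borel)"
proof -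
  have "(\<lambda>p. \<integral>\<^sup>+s'. \<phi> (s', snd p * wgt (fst p) s') \<partial>step C (fst p)) \<in> borel_measurable (state_space C \<Otimes>\<^sub>M borel)"
    by (rule nn_integral_measurable_subprob_algebra2[where N="state_space C"]) measurable
  then show ?thesis by (simp add: weighted_step_def split_beta')
qed

lemma measurable_weighted_step_funpow:
  assumes "\<phi> \<in> borel_measurable (state_space C \<Otimes>\<^sub>M borel)"
  shows "(weighted_step ^^ n) \<phi> \<in> borel_measurable (state_space C \<Otimes>\<^sub>M borel)"
  using assms by (induction n) (auto intro: measurable_weighted_step)

text \<open>The pair of state and weight is a Markov chain; the induction peels off the last step,
  so \<open>\<phi>\<close> must be arbitrary. Writing an expectation over runs as an iterate permits
  a step-by-step comparison with the restarting graph.\<close>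

lemma nn_integral_acc_weight:
  assumes "\<phi> \<in> borel_measurable (state_space C \<Otimes>\<^sub>M borel)"
  shows "(\<integral>\<^sup>+\<rho>. \<phi> (\<rho> n, acc_weight n \<rho>) \<partial>run_measure C) = (weighted_step ^^ n) \<phi> (init_state C, 1)"
  using assms
proof (induction n arbitrary: \<phi>)
  case 0
  have "AE \<rho> in run_measure C. \<phi> (\<rho> 0, acc_weight 0 \<rho>) = \<phi> (init_state C, 1)"
    using AE_run_init by eventually_elim (simp add: acc_weight_def)
  then show ?case
    by (simp add: nn_integral_AE_const[OF prob_space_axioms])
next
  case (Suc n)
  note [measurable] = Suc.prems
  have acc: "acc_weight n (restrict \<rho> {..n}) = acc_weight n \<rho>" for \<rho>
    by (auto simp: acc_weight_def intro!: prod.cong)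
  have m: "(\<lambda>\<rho>. (\<rho> n, acc_weight n \<rho>)) \<in> PiM {..n} (\<lambda>_. state_space C) \<rightarrow>\<^sub>M state_space C \<Otimes>\<^sub>M borel"
    unfolding acc_weight_def by measurable
  have "(\<lambda>p. \<phi> (snd p, snd (fst p) * wgt (fst (fst p)) (snd p))) \<in> borel_measurable ((state_space C \<Otimes>\<^sub>M borel) \<Otimes>\<^sub>M state_space C)"
    by measurable
  from markov_property[OF this m]
  have "(\<integral>\<^sup>+\<rho>. \<phi> (\<rho> (Suc n), acc_weight (Suc n) \<rho>) \<partial>run_measure C) =
      (\<integral>\<^sup>+\<rho>. weighted_step \<phi> (\<rho> n, acc_weight n \<rho>) \<partial>run_measure C)"
    by (simp add: acc weighted_step_def) (simp add: acc_weight_def)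
  also have "\<dots> = (weighted_step ^^ n) (weighted_step \<phi>) (init_state C, 1)"
    by (rule Suc.IH[OF measurable_weighted_step[OF Suc.prems]])
  finally show ?case by (simp add: funpow_swap1)
qed

end

section \<open>Optional stopping\<close>

text \<open>The bound is \<open>\<bar>Y 0 x\<bar>\<close> plus the total variation of the sequence,
  whose expectation is the given sum by monotone convergence.\<close>

lemma dominated_if_summable_increments:
  fixes Y :: "nat \<Rightarrow> 'a \<Rightarrow> real"
  assumes int[measurable]: "\<And>n. integrable M (Y n)"
    and sum: "summable (\<lambda>n. \<integral>x. \<bar>Y (Suc n) x - Y n x\<bar> \<partial>M)"
  shows "\<exists>G. integrable M G \<and> (\<forall>n. AE x in M. \<bar>Y n x\<bar> \<le> G x)"
proof -
  \<comment> \<open>Taken in \<open>ennreal\<close>, so that the series makes sense before it is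
    known to be finite almost everywhere.\<close>
  define D where "D x = (\<Sum>n. ennreal \<bar>Y (Suc n) x - Y n x\<bar>)" for x
  have [measurable]: "D \<in> borel_measurable M" unfolding D_def by measurable
  have "(\<integral>\<^sup>+x. D x \<partial>M) = (\<Sum>n. \<integral>\<^sup>+x. ennreal \<bar>Y (Suc n) x - Y n x\<bar> \<partial>M)"
    unfolding D_def by (rule nn_integral_suminf) measurable
  also have "\<dots> = (\<Sum>n. ennreal (\<integral>x. \<bar>Y (Suc n) x - Y n x\<bar> \<partial>M))"
    by (intro suminf_cong nn_integral_eq_integral) (auto intro!: int)
  also have "\<dots> < \<infinity>"
    using sum by (simp add: suminf_ennreal2 integral_nonneg_AE ennreal_less_top)
  finally have D: "(\<integral>\<^sup>+x. D x \<partial>M) < \<infinity>" .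
  then have fin: "AE x in M. D x < \<infinity>"
    using nn_integral_PInf_AE[of D M] by (auto simp: less_top)
  have "(\<integral>\<^sup>+x. ennreal (enn2real (D x)) \<partial>M) = (\<integral>\<^sup>+x. D x \<partial>M)"
    using fin by (intro nn_integral_cong_AE) (auto simp: less_top)
  then have intD: "integrable M (\<lambda>x. enn2real (D x))"
    using D by (intro integrableI_nonneg) auto
  have bound: "\<bar>Y n x\<bar> \<le> \<bar>Y 0 x\<bar> + enn2real (D x)" if x: "D x < \<infinity>" for n x
  proof -
    have summ: "summable (\<lambda>n. \<bar>Y (Suc n) x - Y n x\<bar>)"
      using x unfolding D_def by (intro summable_suminf_not_top) auto
    have "\<bar>Y n x\<bar> \<le> \<bar>Y 0 x\<bar> + (\<Sum>i<n. \<bar>Y (Suc i) x - Y i x\<bar>)"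
      by (induction n) auto
    also have "(\<Sum>i<n. \<bar>Y (Suc i) x - Y i x\<bar>) \<le> (\<Sum>i. \<bar>Y (Suc i) x - Y i x\<bar>)"
      by (rule sum_le_suminf[OF summ]) auto
    also have "\<dots> = enn2real (D x)"
      unfolding D_def by (simp add: suminf_ennreal2[OF _ summ] suminf_nonneg[OF summ])
    finally show ?thesis by simp
  qed
  show ?thesis
  proof (intro exI conjI allI)
    show "integrable M (\<lambda>x. \<bar>Y 0 x\<bar> + enn2real (D x))"
      using int[of 0] intD by auto
    show "AE x in M. \<bar>Y n x\<bar> \<le> \<bar>Y 0 x\<bar> + enn2real (D x)" for n
      using fin by eventually_elim (rule bound)
  qed
qed

text \<open>In \<open>ereal\<close>, negation does not swap the terms of a difference when both are
  infinite; the assumption excludes that case.\<close>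

lemma ext_expectation_uminus:
  assumes "has_expectation N g"
  shows "ext_expectation N (\<lambda>y. - g y) = - ext_expectation N g"
  using assms unfolding has_expectation_def ext_expectation_def
  by (auto simp: ereal_minus_diff_eq less_top[symmetric] enn2ereal_eq_top_iff)

lemma UESM_uminus:
  assumes "LESM C I f L"
  shows "UESM C I (\<lambda>x. - f x) (\<lambda>l x. - L l x)"
proof -
  have L: "state_function C L" "\<And>x. x \<in> space (valuations (vars C)) \<Longrightarrow> I (term_loc C) x \<Longrightarrow> L (term_loc C) x = 0"
    and step: "\<And>l l' x. (l, l') \<in> trans C \<Longrightarrow> x \<in> space (valuations (vars C)) \<Longrightarrow> I l x \<Longrightarrow> guard C (l, l') x \<Longrightarrow>
      has_expectation (next_val C (l, l') x) (\<lambda>y. L l' y + f (restrict y (outs C))) \<and>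
      ereal (L l x + f (restrict x (outs C))) \<le>
        ext_expectation (next_val C (l, l') x) (\<lambda>y. L l' y + f (restrict y (outs C)))"
    using assms unfolding LESM_def by auto
  have eq: "- a + - b = - (a + b)" for a b :: real by simp
  have neg: "has_expectation N (\<lambda>y. - g y)" if "has_expectation N g" for N :: "('b \<Rightarrow> real) measure" and g
    using that by (auto simp: has_expectation_def)
  have "has_expectation (next_val C (l, l') x) (\<lambda>y. - L l' y + - f (restrict y (outs C))) \<and>
      ereal (- L l x + - f (restrict x (outs C))) \<ge>
        ext_expectation (next_val C (l, l') x) (\<lambda>y. - L l' y + - f (restrict y (outs C)))"
    if "(l, l') \<in> trans C" "x \<in> space (valuations (vars C))" "I l x" "guard C (l, l') x" for l l' x
    unfolding eq ext_expectation_uminus[OF conjunct1[OF step[OF that]]] uminus_ereal.simps(1)[symmetric]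
      ereal_minus_le_minus
    using step[OF that] neg by blast
  then show ?thesis
    using L unfolding UESM_def state_function_def by auto
qed

lemma ost_process_uminus:
  "ost_process C (\<lambda>l x. - \<eta> l x) (\<lambda>x. - f x) n \<rho> = - ost_process C \<eta> f n \<rho>"
  by (simp add: ost_process_def)

text \<open>Apart from integrability, the conditions involve the process only through absolute
  values of it and of its increments.\<close>

lemma ost_sound_uminus: "ost_sound C \<eta> f \<Longrightarrow> ost_sound C (\<lambda>l x. - \<eta> l x) (\<lambda>x. - f x)"
proof -
  have eq: "\<bar>- a - - b\<bar> = \<bar>a - b\<bar>" for a b :: real by simp
  have "integrable M (\<lambda>\<rho>. - ost_process C \<eta> f n \<rho>)" if "integrable M (ost_process C \<eta> f n)" for M n
    using that by simp
  then show "ost_sound C \<eta> f \<Longrightarrow> ost_sound C (\<lambda>l x. - \<eta> l x) (\<lambda>x. - f x)"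
    unfolding ost_sound_def ost_C2_def ost_C3_def ost_C4_def ost_process_uminus[abs_def] eq abs_minus_cancel
    by blast
qed

context wf_pcfg
begin

text \<open>Given the past, the positive and the negative part of \<open>g\<close> are integrated
  separately against \<open>step C (\<rho> n)\<close>. Integrability at time \<open>Suc n\<close>
  makes both integrals finite for almost every history, so the extended expectation is there a
  difference of reals.\<close>

lemma expectation_step_le:
  assumes g[measurable]: "g \<in> borel_measurable (state_space C)"
    and int: "integrable (run_measure C) (\<lambda>\<rho>. g (\<rho> n))" "integrable (run_measure C) (\<lambda>\<rho>. g (\<rho> (Suc n)))"
    and le: "AE \<rho> in run_measure C. ext_expectation (step C (\<rho> n)) g \<le> ereal (g (\<rho> n))"
  shows "(\<integral>\<rho>. g (\<rho> (Suc n)) \<partial>run_measure C) \<le> (\<integral>\<rho>. g (\<rho> n) \<partial>run_measure C)"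
proof -
  \<comment> \<open>The integral of the positive part of \<open>h\<close> given the state at time
    \<open>n\<close>, since \<open>ennreal\<close> sends negative values to 0. It is used for
    \<open>g\<close> and for its negative.\<close>
  define a where "a h \<rho> = (\<integral>\<^sup>+s. ennreal (h s) \<partial>step C (\<rho> n))" for h and \<rho> :: "nat \<Rightarrow> ('l, 'v) state"
  have [measurable]: "a h \<in> borel_measurable (run_measure C)" if [measurable]: "h \<in> borel_measurable (state_space C)" for h
    unfolding a_def
    by (rule measurable_compose[OF measurable_run_component nn_integral_measurable_subprob_algebra2[OF _ measurable_step_subprob]])
       measurable
  have a: "integrable (run_measure C) (\<lambda>\<rho>. enn2real (a h \<rho>))" (is ?A)
    "(\<integral>\<rho>. enn2real (a h \<rho>) \<partial>run_measure C) = enn2real (\<integral>\<^sup>+\<rho>. ennreal (h (\<rho> (Suc n))) \<partial>run_measure C)" (is ?B)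
    "AE \<rho> in run_measure C. a h \<rho> < \<infinity>" (is ?C)
    if [measurable]: "h \<in> borel_measurable (state_space C)"
      and fin: "(\<integral>\<^sup>+\<rho>. ennreal (h (\<rho> (Suc n))) \<partial>run_measure C) < \<infinity>" for h
  proof -
    have eq: "(\<integral>\<^sup>+\<rho>. ennreal (h (\<rho> (Suc n))) \<partial>run_measure C) = (\<integral>\<^sup>+\<rho>. a h \<rho> \<partial>run_measure C)"
      unfolding a_def by (rule markov_single) measurable
    show ?C using fin unfolding eq using nn_integral_PInf_AE[of "a h" "run_measure C"] by (auto simp: less_top)
    have eq2: "(\<integral>\<^sup>+\<rho>. ennreal (enn2real (a h \<rho>)) \<partial>run_measure C) = (\<integral>\<^sup>+\<rho>. a h \<rho> \<partial>run_measure C)"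
      using \<open>?C\<close> by (intro nn_integral_cong_AE) (auto simp: less_top)
    show ?A
      using fin by (intro integrableI_nonneg) (auto simp: eq eq2)
    show ?B
      by (subst integral_eq_nn_integral) (auto simp: eq eq2)
  qed
  have fin: "(\<integral>\<^sup>+\<rho>. ennreal (g (\<rho> (Suc n))) \<partial>run_measure C) < \<infinity>"
    "(\<integral>\<^sup>+\<rho>. ennreal (- g (\<rho> (Suc n))) \<partial>run_measure C) < \<infinity>"
    using int(2) by (auto simp: real_integrable_def less_top)
  have m: "(\<lambda>s. - g s) \<in> borel_measurable (state_space C)" by measurable
  note p = a[OF g fin(1)] and q = a[OF m fin(2)]
  have "(\<integral>\<rho>. g (\<rho> (Suc n)) \<partial>run_measure C) =
      (\<integral>\<rho>. enn2real (a g \<rho>) \<partial>run_measure C) - (\<integral>\<rho>. enn2real (a (\<lambda>s. - g s) \<rho>) \<partial>run_measure C)"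
    unfolding p(2) q(2) by (rule real_lebesgue_integral_def[OF int(2)])
  also have "\<dots> = (\<integral>\<rho>. enn2real (a g \<rho>) - enn2real (a (\<lambda>s. - g s) \<rho>) \<partial>run_measure C)"
    using p(1) q(1) by simp
  also have "\<dots> \<le> (\<integral>\<rho>. g (\<rho> n) \<partial>run_measure C)"
  proof (rule integral_mono_AE)
    show "AE \<rho> in run_measure C. enn2real (a g \<rho>) - enn2real (a (\<lambda>s. - g s) \<rho>) \<le> g (\<rho> n)"
      using le p(3) q(3)
    proof eventually_elim
      case (elim \<rho>)
      then obtain r t where "a g \<rho> = ennreal r" "a (\<lambda>s. - g s) \<rho> = ennreal t" "0 \<le> r" "0 \<le> t"
        by (metis ennreal_cases infinity_ennreal_def less_irrefl)
      moreover have "enn2ereal (a g \<rho>) - enn2ereal (a (\<lambda>s. - g s) \<rho>) \<le> ereal (g (\<rho> n))"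
        using elim(1) by (simp add: ext_expectation_def a_def)
      ultimately show ?case by (simp add: enn2ereal_ennreal)
    qed
  qed (use p(1) q(1) int(1) in auto)
  finally show ?thesis .
qed

section \<open>Summability of the expected increments\<close>

lemma subalgebra_filt: "subalgebra (run_measure C) (filt C t)"
  unfolding subalgebra_def filt_def
  using sets_image_in_sets[OF refl measurable_run_restrict[of "{..t}"]] by simp

lemma not_term_loc_in_filt: "{\<rho>\<in>space (run_measure C). fst (\<rho> t) \<noteq> term_loc C} \<in> sets (filt C t)"
proof -
  have "Measurable.pred (PiM {..t} (\<lambda>_. state_space C)) (\<lambda>\<sigma>. fst (\<sigma> t) \<in> {term_loc C})"
    using term_loc_in
    by (intro pred_sets2[OF _ measurable_compose[where g=fst, OF _ measurable_fst_state]]) auto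
  then have "{\<sigma>\<in>space (PiM {..t} (\<lambda>_. state_space C)). fst (\<sigma> t) \<noteq> term_loc C} \<in> sets (PiM {..t} (\<lambda>_. state_space C))"
    by simp
  from in_vimage_algebra[OF this, of "\<lambda>\<rho>. restrict \<rho> {..t}" "space (run_measure C)"]
  have "(\<lambda>\<rho>. restrict \<rho> {..t}) -` {\<sigma>\<in>space (PiM {..t} (\<lambda>_. state_space C)). fst (\<sigma> t) \<noteq> term_loc C} \<inter> space (run_measure C) \<in> sets (filt C t)"
    unfolding filt_def .
  also have "(\<lambda>\<rho>. restrict \<rho> {..t}) -` {\<sigma>\<in>space (PiM {..t} (\<lambda>_. state_space C)). fst (\<sigma> t) \<noteq> term_loc C} \<inter> space (run_measure C)
      = {\<rho>\<in>space (run_measure C). fst (\<rho> t) \<noteq> term_loc C}"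
    using measurable_space[OF measurable_run_restrict] by auto
  finally show ?thesis .
qed

definition alive :: "nat \<Rightarrow> (nat \<Rightarrow> ('l, 'v) state) set" where
  "alive n = {\<rho>\<in>space (run_measure C). fst (\<rho> n) \<noteq> term_loc C}"

lemma alive_measurable [measurable]: "alive n \<in> sets (run_measure C)"
  unfolding alive_def by measurable

text \<open>The event \<open>alive n\<close> lies in \<open>filt C n\<close>, so on it
  \<open>g\<close> may be replaced by its conditional expectation, which is at most
  \<open>c\<close>; off it \<open>g\<close> vanishes.\<close>

lemma integral_cond_exp_bound:
  fixes g :: "(nat \<Rightarrow> ('l, 'v) state) \<Rightarrow> real"
  assumes g: "integrable (run_measure C) g" "\<And>\<rho>. 0 \<le> g \<rho>"
    and zero: "AE \<rho> in run_measure C. \<rho> \<notin> alive n \<longrightarrow> g \<rho> = 0"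
    and c: "AE \<rho> in run_measure C. real_cond_exp (run_measure C) (filt C n) g \<rho> \<le> c"
  shows "(\<integral>\<rho>. g \<rho> \<partial>run_measure C) \<le> c * measure (run_measure C) (alive n)"
proof -
  interpret F: finite_measure_subalgebra "run_measure C" "filt C n"
    by unfold_locales (rule subalgebra_filt)
  have A: "alive n \<in> sets (filt C n)" unfolding alive_def by (rule not_term_loc_in_filt)
  have "(\<integral>\<rho>. g \<rho> \<partial>run_measure C) = (\<integral>\<rho>\<in>alive n. g \<rho> \<partial>run_measure C)"
    unfolding set_lebesgue_integral_def
    using zero g by (intro integral_cong_AE) (auto simp: indicator_def borel_measurable_integrable)
  also have "\<dots> = (\<integral>\<rho>\<in>alive n. real_cond_exp (run_measure C) (filt C n) g \<rho> \<partial>run_measure C)"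
    by (rule F.real_cond_exp_intA[OF g(1) A])
  also have "\<dots> \<le> (\<integral>\<rho>\<in>alive n. c \<partial>run_measure C)"
    unfolding set_lebesgue_integral_def
    using c F.real_cond_exp_int(1)[OF g(1)]
    by (intro integral_mono_AE integrable_mult_indicator alive_measurable) (auto simp: indicator_def)
  also have "\<dots> = c * measure (run_measure C) (alive n)"
    by (simp add: set_lebesgue_integral_def sets.Int_space_eq2[OF alive_measurable])
  finally show ?thesis .
qed

lemma term_time_gt_iff: "\<rho> \<in> runs C \<Longrightarrow> enat n < term_time C \<rho> \<longleftrightarrow> \<rho> \<in> alive n"
  unfolding not_le[symmetric] using term_time_le_iff[of \<rho> n] runs_subset_space by (auto simp: alive_def)

text \<open>Half of the tail-sum formula for an expectation: along a run that terminates at time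
  \<open>k\<close>, exactly the first \<open>k\<close> indicators are 1.\<close>

lemma suminf_prob_alive_le:
  "(\<Sum>n. emeasure (run_measure C) (alive n)) \<le> (\<integral>\<^sup>+\<rho>. ennreal_of_enat (term_time C \<rho>) \<partial>run_measure C)"
proof -
  have "(\<Sum>n. emeasure (run_measure C) (alive n)) = (\<Sum>n. \<integral>\<^sup>+\<rho>. indicator (alive n) \<rho> \<partial>run_measure C)"
    by (intro suminf_cong nn_integral_indicator[symmetric] alive_measurable)
  also have "\<dots> = (\<integral>\<^sup>+\<rho>. (\<Sum>n. indicator (alive n) \<rho>) \<partial>run_measure C)"
    by (rule nn_integral_suminf[symmetric]) measurable
  also have "\<dots> \<le> (\<integral>\<^sup>+\<rho>. ennreal_of_enat (term_time C \<rho>) \<partial>run_measure C)"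
  proof (rule nn_integral_mono_AE)
    show "AE \<rho> in run_measure C. (\<Sum>n. indicator (alive n) \<rho>) \<le> ennreal_of_enat (term_time C \<rho>)"
      using AE_runs
    proof eventually_elim
      case (elim \<rho>)
      show ?case
      proof (cases "term_time C \<rho>")
        case (enat k)
        have "(\<Sum>n. indicator (alive n) \<rho> :: ennreal) = (\<Sum>n<k. indicator (alive n) \<rho>)"
          using term_time_gt_iff[OF elim] by (intro suminf_finite) (auto simp: enat)
        also have "\<dots> \<le> (\<Sum>n<k. 1)"
          by (intro sum_mono) (auto simp: indicator_def)
        finally show ?thesis by (simp add: enat)
      qed simp
    qed
  qed
  finally show ?thesis .
qed

text \<open>After termination the process stands still, so increment \<open>n\<close> lives on
  \<open>alive n\<close>. In (C1) it vanishes almost surely from index \<open>c\<close> on, in (C3)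
  its expectation is at most \<open>c * prob (alive n)\<close>, and in (C4) a power of
  \<open>n\<close> meets an exponentially small probability.\<close>

lemma summable_ost_increments:
  assumes ost: "ost_C1 C \<or> ost_C3 C \<eta> f \<or> ost_C4 C \<eta> f"
    and int: "\<And>n. integrable (run_measure C) (ost_process C \<eta> f n)"
  shows "summable (\<lambda>n. \<integral>\<rho>. \<bar>ost_process C \<eta> f (Suc n) \<rho> - ost_process C \<eta> f n \<rho>\<bar> \<partial>run_measure C)"
proof -
  define g where "g n \<rho> = \<bar>ost_process C \<eta> f (Suc n) \<rho> - ost_process C \<eta> f n \<rho>\<bar>" for n \<rho>
  have g[simp, intro]: "integrable (run_measure C) (g n)" for n
    unfolding g_def using int by auto
  have g0[simp]: "0 \<le> g n \<rho>" for n \<rho> by (simp add: g_def)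
  have zero: "AE \<rho> in run_measure C. \<rho> \<notin> alive n \<longrightarrow> g n \<rho> = 0" for n
    using AE_runs
  proof eventually_elim
    case (elim \<rho>)
    then show ?case
      using runs_stay[OF elim, of n "Suc n"] runs_subset_space by (auto simp: alive_def g_def ost_process_def)
  qed
  have "summable (\<lambda>n. \<integral>\<rho>. g n \<rho> \<partial>run_measure C)"
    using ost
  proof (elim disjE)
    assume "ost_C1 C"
    then obtain c :: nat where c: "AE \<rho> in run_measure C. term_time C \<rho> \<le> enat c"
      by (auto simp: ost_C1_def)
    have "(\<integral>\<rho>. g n \<rho> \<partial>run_measure C) = 0" if n: "c \<le> n" for n
    proof -
      have "AE \<rho> in run_measure C. g n \<rho> = 0"
        using c zero[of n] AE_runs
      proof eventually_elim
        case (elim \<rho>)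
        have "term_time C \<rho> \<le> enat n" using elim(1) n by (meson enat_ord_simps(1) order_trans)
        then show ?case using elim term_time_gt_iff[of \<rho> n] by auto
      qed
      then show ?thesis by (rule integral_eq_zero_AE)
    qed
    then show ?thesis by (intro summable_finite[of "{..<c}"]) auto
  next
    assume C3: "ost_C3 C \<eta> f"
    then obtain c where c: "\<And>n. 1 \<le> n \<Longrightarrow> AE \<rho> in run_measure C. real_cond_exp (run_measure C) (filt C n) (g n) \<rho> \<le> c"
      unfolding ost_C3_def g_def by blast
    have bound: "(\<integral>\<rho>. g n \<rho> \<partial>run_measure C) \<le> c * prob (alive n)" if "1 \<le> n" for n
      by (rule integral_cond_exp_bound[OF _ _ zero c[OF that]]) auto
    have "(\<Sum>n. ennreal (prob (alive n))) < \<infinity>"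
      using le_less_trans[OF suminf_prob_alive_le] C3 by (simp add: ost_C3_def emeasure_eq_measure)
    then have "summable (\<lambda>n. prob (alive n))"
      by (intro summable_suminf_not_top) auto
    then have "summable (\<lambda>n. c * prob (alive n))" by (rule summable_mult)
    \<comment> \<open>The conditional bound is available from index 1 on, hence
      \<open>N=1\<close>.\<close>
    then show ?thesis
      by (rule summable_comparison_test'[where N=1]) (use bound in \<open>auto simp: integral_nonneg_AE\<close>)
  next
    assume "ost_C4 C \<eta> f"
    then obtain M c1 c2 d :: real where c2: "c2 > 0"
      and tail: "\<forall>\<^sub>F n in sequentially. measure (run_measure C) {\<rho>\<in>space (run_measure C). term_time C \<rho> > enat n} \<le> c1 * exp (- c2 * real n)"
      and M: "\<And>n. 1 \<le> n \<Longrightarrow> AE \<rho> in run_measure C. g n \<rho> \<le> M * real n powr d"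
      unfolding ost_C4_def g_def by blast
    \<comment> \<open>The two events agree on runs; elsewhere a sequence may leave the terminal
      location again, so the comparison is almost sure.\<close>
    have alive: "measure (run_measure C) {\<rho>\<in>space (run_measure C). term_time C \<rho> > enat n} = prob (alive n)" for n
    proof (rule measure_eq_AE)
      show "AE \<rho> in run_measure C. \<rho> \<in> {\<rho>\<in>space (run_measure C). term_time C \<rho> > enat n} \<longleftrightarrow> \<rho> \<in> alive n"
        using AE_runs by eventually_elim (use term_time_gt_iff runs_subset_space in auto)
      have "{\<rho>\<in>space (run_measure C). term_time C \<rho> > enat n} =
        {\<rho>\<in>space (run_measure C). \<forall>i\<le>n. fst (\<rho> i) \<noteq> term_loc C}"
      proof -
        have "term_time C \<rho> \<le> enat n \<longleftrightarrow> (\<exists>i\<le>n. fst (\<rho> i) = term_loc C)" for \<rho>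
          unfolding term_time_def by (auto intro: LeastI Least_le order_trans)
        then show ?thesis unfolding not_le[symmetric] by auto
      qed
      also have "\<dots> \<in> sets (run_measure C)" by measurable
      finally show "{\<rho>\<in>space (run_measure C). term_time C \<rho> > enat n} \<in> sets (run_measure C)" .
    qed measurable
    have bound: "(\<integral>\<rho>. g n \<rho> \<partial>run_measure C) \<le> M * real n powr d * prob (alive n)" if "1 \<le> n" for n
    proof -
      have "(\<integral>\<rho>. g n \<rho> \<partial>run_measure C) \<le> (\<integral>\<rho>. M * real n powr d * indicator (alive n) \<rho> \<partial>run_measure C)"
      proof (rule integral_mono_AE)
        show "AE \<rho> in run_measure C. g n \<rho> \<le> M * real n powr d * indicator (alive n) \<rho>"
          using M[OF that] zero[of n] by eventually_elim (auto simp: indicator_def)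
        show "integrable (run_measure C) (\<lambda>\<rho>. M * real n powr d * indicator (alive n) \<rho>)"
          by (intro integrable_mult_right integrable_real_indicator alive_measurable) (simp add: emeasure_eq_measure)
      qed auto
      then show ?thesis by (simp add: sets.Int_space_eq2[OF alive_measurable])
    qed
    \<comment> \<open>The constants of (C4) may be negative, so the majorant uses their absolute
      values.\<close>
    have "summable (\<lambda>n. \<bar>M\<bar> * real n powr d * (\<bar>c1\<bar> * exp (- c2 * real n)))"
    proof (rule summable_comparison_test_bigo)
      show "summable (\<lambda>n. norm (1 / real n ^ 2))"
        using inverse_power_summable[of 2, where ?'a=real] by (simp add: field_simps)
      show "(\<lambda>n. \<bar>M\<bar> * real n powr d * (\<bar>c1\<bar> * exp (- c2 * real n))) \<in> O(\<lambda>n. 1 / real n ^ 2)"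
      proof -
        have "(\<lambda>n. real n powr d * exp (- c2 * real n)) \<in> O(\<lambda>n. 1 / real n ^ 2)"
          using c2 by real_asymp
        from landau_o.big.mult[OF bigo_const this, of "\<bar>M\<bar> * \<bar>c1\<bar>"] show ?thesis
          by (simp add: mult_ac)
      qed
    qed
    moreover have "\<forall>\<^sub>F n in sequentially. norm (\<integral>\<rho>. g n \<rho> \<partial>run_measure C) \<le> \<bar>M\<bar> * real n powr d * (\<bar>c1\<bar> * exp (- c2 * real n))"
      using tail eventually_ge_at_top[of 1]
    proof eventually_elim
      case (elim n)
      have "(\<integral>\<rho>. g n \<rho> \<partial>run_measure C) \<le> M * real n powr d * prob (alive n)"
        by (rule bound[OF elim(2)])
      also have "\<dots> \<le> \<bar>M\<bar> * real n powr d * prob (alive n)"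
        by (intro mult_right_mono) auto
      also have "\<dots> \<le> \<bar>M\<bar> * real n powr d * (\<bar>c1\<bar> * exp (- c2 * real n))"
        using elim(1) unfolding alive
        by (intro mult_left_mono order_trans[OF elim(1)[unfolded alive]] mult_right_mono) auto
      finally show ?case by (simp add: integral_nonneg_AE)
    qed
    ultimately show ?thesis
      by (rule summable_comparison_test_ev[rotated])
  qed
  then show ?thesis by (simp add: g_def)
qed

theorem UESM_bound:
  assumes ast: "as_terminating C" and inv: "invariant C I" and UESM: "UESM C I f \<eta>"
    and f[measurable]: "f \<in> borel_measurable (valuations (outs C))" and ost: "ost_sound C \<eta> f"
  shows "integrable (run_measure C) (\<lambda>\<rho>. f (out_val \<rho>))"
    and "(\<integral>\<rho>. f (out_val \<rho>) \<partial>run_measure C) \<le> \<eta> (init_loc C) (init_val C) + f (restrict (init_val C) (outs C))"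
proof -
  let ?Y = "ost_process C \<eta> f"
  define g where "g = (\<lambda>s. \<eta> (fst s) (snd s) + f (restrict (snd s) (outs C)))"
  have Y: "?Y n \<rho> = g (\<rho> n)" for n \<rho> by (simp add: ost_process_def g_def)
  have int: "integrable (run_measure C) (?Y n)" for n using ost by (simp add: ost_sound_def)
  have m[measurable]: "g \<in> borel_measurable (state_space C)"
  proof -
    have "(\<lambda>x. \<eta> l x) \<in> borel_measurable (valuations (vars C))" if "l \<in> locs C" for l
      using UESM that by (simp add: UESM_def state_function_def)
    moreover have "(\<lambda>x. f (restrict x (outs C))) \<in> borel_measurable (valuations (vars C))"
      by (rule measurable_compose[OF measurable_restrict_outs f])
    ultimately show ?thesis
      unfolding g_def by (intro measurable_state_spaceI) auto
  qed
  have step: "(\<integral>\<rho>. ?Y (Suc n) \<rho> \<partial>run_measure C) \<le> (\<integral>\<rho>. ?Y n \<rho> \<partial>run_measure C)" for n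
    unfolding Y
  proof (rule expectation_step_le[OF m])
    show "integrable (run_measure C) (\<lambda>\<rho>. g (\<rho> n))" "integrable (run_measure C) (\<lambda>\<rho>. g (\<rho> (Suc n)))"
      using int[of n] int[of "Suc n"] by (auto simp: Y[abs_def])
    \<comment> \<open>States of a run are reachable, so the invariant holds there and the
      supermartingale condition applies to the enabled transition.\<close>
    show "AE \<rho> in run_measure C. ext_expectation (step C (\<rho> n)) g \<le> ereal (g (\<rho> n))"
      using AE_runs
    proof eventually_elim
      case (elim \<rho>)
      obtain l x where s: "\<rho> n = (l, x)" by (cases "\<rho> n")
      have I: "I l x" using inv runs_reachable[OF elim, of n] by (simp add: invariant_def s)
      have "\<rho> n \<in> space (state_space C)"
        using run_in_space runs_subset_space elim by blast
      then have lx: "l \<in> locs C" "x \<in> space (valuations (vars C))"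
        by (auto simp: s space_state_space)
      have en: "enabled C l x (next_loc l x)" using enabled_next_loc[OF lx] .
      have m': "(\<lambda>s. ennreal (g s)) \<in> borel_measurable (state_space C)"
        "(\<lambda>s. ennreal (- g s)) \<in> borel_measurable (state_space C)" by measurable
      have "ext_expectation (step C (l, x)) g =
          ext_expectation (next_val C (l, next_loc l x) x) (\<lambda>y. \<eta> (next_loc l x) y + f (restrict y (outs C)))"
        unfolding ext_expectation_def nn_integral_step[OF lx en m'(1)] nn_integral_step[OF lx en m'(2)]
        by (simp add: g_def)
      also have "\<dots> \<le> ereal (\<eta> l x + f (restrict x (outs C)))"
      proof -
        have "\<forall>x\<in>space (valuations (vars C)). I l x \<and> guard C (l, next_loc l x') x \<longrightarrow>
            ext_expectation (next_val C (l, next_loc l x') x) (\<lambda>y. \<eta> (next_loc l x') y + f (restrict y (outs C)))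
              \<le> ereal (\<eta> l x + f (restrict x (outs C)))" if "(l, next_loc l x') \<in> trans C" for x'
          using UESM that unfolding UESM_def by blast
        from this[of x] show ?thesis using en I lx unfolding enabled_def by blast
      qed
      finally show ?case by (simp add: s g_def)
    qed
  qed
  have decr: "(\<integral>\<rho>. ?Y n \<rho> \<partial>run_measure C) \<le> (\<integral>\<rho>. ?Y 0 \<rho> \<partial>run_measure C)" for n
    by (induction n) (use step order_trans in blast)+
  have init: "(\<integral>\<rho>. ?Y 0 \<rho> \<partial>run_measure C) = \<eta> (init_loc C) (init_val C) + f (restrict (init_val C) (outs C))"
  proof -
    have "(\<integral>\<rho>. ?Y 0 \<rho> \<partial>run_measure C) = (\<integral>\<rho>. g (init_state C) \<partial>run_measure C)"
      using AE_run_init by (intro integral_cong_AE) (auto simp: Y)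
    also have "\<dots> = g (init_state C)" by (simp add: prob_space)
    finally show ?thesis by (simp add: g_def)
  qed
  have stopped: "?Y n \<rho> = f (out_val \<rho>)" if \<rho>: "\<rho> \<in> runs C" and n: "fst (\<rho> n) = term_loc C" for n \<rho>
  proof -
    have "I (term_loc C) (snd (\<rho> n))"
      using inv runs_reachable[OF \<rho>, of n] n by (metis invariant_def prod.collapse)
    moreover have "snd (\<rho> n) \<in> space (valuations (vars C))"
      using run_in_space[of \<rho> n] runs_subset_space \<rho> by (auto simp: space_state_space mem_Times_iff)
    ultimately have "\<eta> (term_loc C) (snd (\<rho> n)) = 0"
      using UESM by (simp add: UESM_def)
    then show ?thesis by (simp add: ost_process_def n out_val_eq[OF \<rho> n])
  qed
  \<comment> \<open>The sequence is shifted by one because (C2) speaks about positive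
    \<open>t\<close>; the limit is the same.\<close>
  have lim: "AE \<rho> in run_measure C. (\<lambda>n. ?Y (Suc n) \<rho>) \<longlonglongrightarrow> f (out_val \<rho>)"
    using AE_runs ast[unfolded as_terminating_def]
  proof eventually_elim
    case (elim \<rho>)
    from elim(2) obtain t where t: "fst (\<rho> t) = term_loc C"
      unfolding term_time_finite_iff by blast
    have "?Y n \<rho> = f (out_val \<rho>)" if "t \<le> n" for n
      using runs_stay[OF elim(1) t that] t by (intro stopped[OF elim(1)]) simp
    then have "\<forall>\<^sub>F n in sequentially. ?Y (Suc n) \<rho> = f (out_val \<rho>)"
      by (intro eventually_sequentiallyI[of t]) auto
    then show ?case by (rule tendsto_eventually)
  qed
  have "\<exists>G. integrable (run_measure C) G \<and> (\<forall>n. AE \<rho> in run_measure C. \<bar>?Y (Suc n) \<rho>\<bar> \<le> G \<rho>)"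
  proof (cases "ost_C2 C \<eta> f")
    case True
    then obtain c where c: "\<And>t \<rho>. 1 \<le> t \<Longrightarrow> \<rho> \<in> runs C \<Longrightarrow> \<bar>?Y (the_enat (min (enat t) (term_time C \<rho>))) \<rho>\<bar> \<le> c"
      unfolding ost_C2_def by blast
    \<comment> \<open>Past the termination time the process keeps its value at that time, which (C2)
      bounds.\<close>
    have bound: "\<bar>?Y (Suc n) \<rho>\<bar> \<le> c" if \<rho>: "\<rho> \<in> runs C" for n \<rho>
    proof (cases "term_time C \<rho> \<le> enat (Suc n)")
      case True
      then obtain k where k: "term_time C \<rho> = enat k" "k \<le> Suc n" by (cases "term_time C \<rho>") auto
      then have "fst (\<rho> k) = term_loc C" using term_time_le_iff[OF \<rho>, of k] by simp
      then have "\<rho> (Suc n) = \<rho> k" using k by (intro runs_stay[OF \<rho>])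
      then have "?Y (Suc n) \<rho> = ?Y k \<rho>" by (simp add: Y)
      then show ?thesis using c[of "Suc n", OF _ \<rho>] k by (simp add: min_absorb2)
    next
      case False
      then have "min (enat (Suc n)) (term_time C \<rho>) = enat (Suc n)" by (simp add: min_absorb1)
      then show ?thesis using c[of "Suc n", OF _ \<rho>] by simp
    qed
    have "AE \<rho> in run_measure C. \<bar>?Y (Suc n) \<rho>\<bar> \<le> c" for n
      using AE_runs by eventually_elim (rule bound)
    then show ?thesis by (intro exI[of _ "\<lambda>_. c"]) simp
  next
    case False
    then have "summable (\<lambda>n. \<integral>\<rho>. \<bar>?Y (Suc n) \<rho> - ?Y n \<rho>\<bar> \<partial>run_measure C)"
      using ost by (intro summable_ost_increments) (auto simp: ost_sound_def)
    then have "summable (\<lambda>n. \<integral>\<rho>. \<bar>?Y (Suc (Suc n)) \<rho> - ?Y (Suc n) \<rho>\<bar> \<partial>run_measure C)"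
      using summable_Suc_iff[of "\<lambda>n. \<integral>\<rho>. \<bar>?Y (Suc n) \<rho> - ?Y n \<rho>\<bar> \<partial>run_measure C"] by simp
    then show ?thesis
      by (intro dominated_if_summable_increments int)
  qed
  then obtain G where G: "integrable (run_measure C) G" "\<And>n. AE \<rho> in run_measure C. norm (?Y (Suc n) \<rho>) \<le> G \<rho>"
    by auto
  have meas: "(\<lambda>\<rho>. f (out_val \<rho>)) \<in> borel_measurable (run_measure C)" "?Y n \<in> borel_measurable (run_measure C)" for n
    using int[of n] by auto
  show "integrable (run_measure C) (\<lambda>\<rho>. f (out_val \<rho>))"
    by (rule integrable_dominated_convergence[OF meas G(1) lim G(2)])
  have "(\<lambda>n. \<integral>\<rho>. ?Y (Suc n) \<rho> \<partial>run_measure C) \<longlonglongrightarrow> (\<integral>\<rho>. f (out_val \<rho>) \<partial>run_measure C)"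
    by (rule integral_dominated_convergence[OF meas G(1) lim G(2)])
  then have "(\<integral>\<rho>. f (out_val \<rho>) \<partial>run_measure C) \<le> (\<integral>\<rho>. ?Y 0 \<rho> \<partial>run_measure C)"
    by (rule LIMSEQ_le_const2) (use decr in blast)
  then show "(\<integral>\<rho>. f (out_val \<rho>) \<partial>run_measure C) \<le> \<eta> (init_loc C) (init_val C) + f (restrict (init_val C) (outs C))"
    by (simp only: init)
qed

section \<open>Excessive functions\<close>

lemma nn_integral_step_funpow:
  assumes [measurable]: "h \<in> borel_measurable (state_space C)"
  defines "K \<equiv> (\<lambda>h s. \<integral>\<^sup>+s'. h s' \<partial>step C s)"
  shows "(K ^^ n) h \<in> borel_measurable (state_space C)"
    and "(K ^^ n) h (init_state C) = (\<integral>\<^sup>+\<rho>. h (\<rho> n) \<partial>run_measure C)"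
proof -
  have K: "K h \<in> borel_measurable (state_space C)" if [measurable]: "h \<in> borel_measurable (state_space C)" for h
    unfolding K_def by (rule nn_integral_measurable_subprob_algebra2[OF _ measurable_step_subprob]) measurable
  show "(K ^^ n) h \<in> borel_measurable (state_space C)"
    using assms(1) by (induction n) (auto intro: K)
  show "(K ^^ n) h (init_state C) = (\<integral>\<^sup>+\<rho>. h (\<rho> n) \<partial>run_measure C)"
    using assms(1)
  proof (induction n arbitrary: h)
    case 0
    have "AE \<rho> in run_measure C. h (\<rho> 0) = h (init_state C)"
      using AE_run_init by eventually_elim simp
    then show ?case by (simp add: nn_integral_AE_const[OF prob_space_axioms])
  next
    case (Suc n)
    have "(K ^^ Suc n) h (init_state C) = (K ^^ n) (K h) (init_state C)" by (simp add: funpow_swap1)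
    also have "\<dots> = (\<integral>\<^sup>+\<rho>. h (\<rho> (Suc n)) \<partial>run_measure C)"
      unfolding Suc.IH[OF K[OF Suc.prems]] by (simp add: K_def markov_single[OF Suc.prems])
    finally show ?case .
  qed
qed

lemma nn_integral_step_term_loc:
  assumes "x \<in> space (valuations (vars C))"
  shows "(\<integral>\<^sup>+s. h s \<partial>step C (term_loc C, x)) = h (term_loc C, x)"
proof -
  have s: "(term_loc C, x) \<in> space (state_space C)"
    using assms term_loc_in by (simp add: space_state_space)
  have "AE s in step C (term_loc C, x). h s = h (term_loc C, x)"
    using AE_step_successor[OF s] by eventually_elim (use successor_term_loc in force)
  then show ?thesis by (rule nn_integral_AE_const[OF prob_space_step[OF s]])
qed

text \<open>Almost every run terminates, with its output either in \<open>B\<close> or in the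
  complement, so the two indicators add up to 1.\<close>

lemma nod_compl:
  assumes ast: "as_terminating C" and int: "integrable_pcfg C" and B: "B \<in> sets (valuations (outs C))"
  shows "nod C B + nod C (space (valuations (outs C)) - B) = 1"
proof -
  let ?B' = "space (valuations (outs C)) - B"
  have intW: "integrable (run_measure C) (cum_weight C)" and pos: "0 < (\<integral>\<rho>. cum_weight C \<rho> \<partial>run_measure C)"
    using int by (auto simp: integrable_pcfg_def)
  have i: "integrable (run_measure C) (\<lambda>\<rho>. indicator (output_runs C D) \<rho> * cum_weight C \<rho>)"
    if "D \<in> sets (valuations (outs C))" for D
    using integrable_mult_indicator[OF measurable_output_runs[OF that] intW] by simp
  have "(\<integral>\<rho>. indicator (output_runs C B) \<rho> * cum_weight C \<rho> \<partial>run_measure C) +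
      (\<integral>\<rho>. indicator (output_runs C ?B') \<rho> * cum_weight C \<rho> \<partial>run_measure C) =
      (\<integral>\<rho>. indicator (output_runs C B) \<rho> * cum_weight C \<rho> + indicator (output_runs C ?B') \<rho> * cum_weight C \<rho> \<partial>run_measure C)"
    using B by (intro Bochner_Integration.integral_add[symmetric] i) auto
  also have "\<dots> = (\<integral>\<rho>. cum_weight C \<rho> \<partial>run_measure C)"
  proof (rule integral_cong_AE)
    show "AE \<rho> in run_measure C. indicator (output_runs C B) \<rho> * cum_weight C \<rho> +
        indicator (output_runs C ?B') \<rho> * cum_weight C \<rho> = cum_weight C \<rho>"
      using AE_runs ast[unfolded as_terminating_def term_time_finite_iff] AE_space
    proof eventually_elim
      case (elim \<rho>)
      have "out_val \<rho> \<in> space (valuations (outs C))"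
        using measurable_space[OF measurable_out_val elim(3)] .
      then show ?case using elim by (auto simp: output_runs_eq indicator_def)
    qed
  qed (use i[of B] i[of ?B'] B intW in auto)
  finally show ?thesis
    using pos by (simp add: nod_def add_divide_distrib[symmetric])
qed

text \<open>
  \<open>H s\<close> is the limit inferior of the probabilities to be terminated with output in \<open>B\<close> after \<open>n\<close>
  steps from \<open>s\<close>; by Fatou's lemma it is excessive.
\<close>

lemma ex_excessive:
  assumes B[measurable]: "B \<in> sets (valuations (outs C))"
  obtains H :: "('l, 'v) state \<Rightarrow> ennreal"
  where "H \<in> borel_measurable (state_space C)"
    and "\<And>s. s \<in> space (state_space C) \<Longrightarrow> (\<integral>\<^sup>+s'. H s' \<partial>step C s) \<le> H s"
    and "\<And>x. x \<in> space (valuations (vars C)) \<Longrightarrow> indicator B (restrict x (outs C)) \<le> H (term_loc C, x)"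
    and "H (init_state C) \<le> emeasure (run_measure C) (output_runs C B)"
proof -
  define K where "K = (\<lambda>h :: ('l, 'v) state \<Rightarrow> ennreal. \<lambda>s. \<integral>\<^sup>+s'. h s' \<partial>step C s)"
  define h :: "('l, 'v) state \<Rightarrow> ennreal" where
    "h s = (if fst s = term_loc C then indicator B (restrict (snd s) (outs C)) else 0)" for s
  define H where "H s = liminf (\<lambda>n. (K ^^ n) h s)" for s
  have h: "h \<in> borel_measurable (state_space C)"
  proof (rule measurable_state_spaceI)
    fix l assume "l \<in> locs C"
    have "(\<lambda>x. indicator B (restrict x (outs C)) :: ennreal) \<in> borel_measurable (valuations (vars C))"
      by (rule measurable_compose[OF measurable_restrict_outs]) measurable
    then show "(\<lambda>x. h (l, x)) \<in> borel_measurable (valuations (vars C))"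
      by (cases "l = term_loc C") (auto simp: h_def)
  qed
  note Kn = nn_integral_step_funpow[OF h, folded K_def]
  have [measurable]: "(K ^^ n) h \<in> borel_measurable (state_space C)" for n by (rule Kn(1))
  show ?thesis
  proof
    show "H \<in> borel_measurable (state_space C)" unfolding H_def[abs_def] by measurable
    fix s assume s: "s \<in> space (state_space C)"
    have "(K ^^ n) h \<in> borel_measurable (step C s)" for n
      using Kn(1) measurable_cong_sets[OF sets_step[OF s] refl] by blast
    then have "(\<integral>\<^sup>+s'. H s' \<partial>step C s) \<le> liminf (\<lambda>n. \<integral>\<^sup>+s'. (K ^^ n) h s' \<partial>step C s)"
      unfolding H_def by (rule nn_integral_liminf)
    also have "\<dots> = liminf (\<lambda>n. (K ^^ (n + 1)) h s)"
      by (simp add: K_def)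
    also have "\<dots> = H s"
      unfolding H_def by (rule liminf_shift)
    finally show "(\<integral>\<^sup>+s'. H s' \<partial>step C s) \<le> H s" .
  next
    fix x assume x: "x \<in> space (valuations (vars C))"
    \<comment> \<open>A terminal state never changes, so all iterates take the same value
      there.\<close>
    have "(K ^^ n) h (term_loc C, x) = indicator B (restrict x (outs C))" for n
    proof (induction n)
      case (Suc n)
      then show ?case using nn_integral_step_term_loc[OF x, of "(K ^^ n) h"] by (simp add: K_def)
    qed (simp add: h_def del: restrict_apply)
    then show "indicator B (restrict x (outs C)) \<le> H (term_loc C, x)"
      unfolding H_def by (intro Liminf_bounded) simp
  next
    \<comment> \<open>The left side is the probability of having terminated by time \<open>n\<close>
      with output in \<open>B\<close>.\<close>
    have "(K ^^ n) h (init_state C) \<le> emeasure (run_measure C) (output_runs C B)" for n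
    proof -
      have "(K ^^ n) h (init_state C) = (\<integral>\<^sup>+\<rho>. h (\<rho> n) \<partial>run_measure C)"
        by (rule Kn(2))
      also have "\<dots> \<le> (\<integral>\<^sup>+\<rho>. indicator (output_runs C B) \<rho> \<partial>run_measure C)"
      proof (rule nn_integral_mono_AE)
        show "AE \<rho> in run_measure C. h (\<rho> n) \<le> indicator (output_runs C B) \<rho>"
          using AE_runs
        proof eventually_elim
          case (elim \<rho>)
          show ?case
          proof (cases "fst (\<rho> n) = term_loc C")
            case True
            then show ?thesis
              using elim by (auto simp: h_def output_runs_eq out_val_eq[OF elim True] indicator_def simp del: restrict_apply)
          qed (simp add: h_def)
        qed
      qed
      also have "\<dots> = emeasure (run_measure C) (output_runs C B)"
        using measurable_output_runs[OF B] by (rule nn_integral_indicator)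
      finally show ?thesis .
    qed
    then show "H (init_state C) \<le> emeasure (run_measure C) (output_runs C B)"
      unfolding H_def by (intro Liminf_le) auto
  qed
qed

end

section \<open>Weighted restarting\<close>

text \<open>To be used with \<open>c = \<omega> / M\<close>. The cap at 1 allows for valuations that
  no run visits, whose weight may exceed \<open>M\<close>.\<close>

lemma nn_integral_uniform_threshold:
  fixes a b :: ennreal
  assumes "0 \<le> c"
  shows "(\<integral>\<^sup>+r. (if r < 1 - c then a else b) \<partial>uniform_measure lborel {0..1::real}) =
    ennreal (min 1 c) * b + ennreal (1 - min 1 c) * a"
proof -
  \<comment> \<open>The length of the interval of samples that lead to a restart.\<close>
  define q where "q = 1 - min 1 c"
  have q: "0 \<le> q" "q \<le> 1" using assms by (auto simp: q_def)
  have "(\<integral>\<^sup>+r. (if r < 1 - c then a else b) \<partial>uniform_measure lborel {0..1::real}) =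
      (\<integral>\<^sup>+r. (if r < 1 - c then a else b) * indicator {0..1} r \<partial>lborel)"
    by (subst nn_integral_uniform_measure) (auto simp: divide_ennreal_def)
  also have "\<dots> = (\<integral>\<^sup>+r. b * indicator {q..1} r + a * indicator {0..<q} r \<partial>lborel)"
    using q by (intro nn_integral_cong) (auto simp: indicator_def q_def min_def split: if_splits)
  also have "\<dots> = b * ennreal (1 - q) + a * ennreal q"
    using q by (simp add: nn_integral_add nn_integral_cmult)
  finally show ?thesis by (simp add: q_def mult.commute)
qed

lemma real_distribution_uniform_01: "real_distribution (uniform_measure lborel {0..1})"
proof -
  interpret prob_space "uniform_measure lborel {0..1::real}"
    by (rule prob_space_uniform_measure) auto
  show ?thesis by unfold_locales auto
qed

locale weighted_restart = wf_pcfg C for C :: "('l, 'v) pcfg" +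
  fixes M :: real and \<omega> u :: 'v
  assumes fresh: "\<omega> \<notin> vars C" "u \<notin> vars C" "\<omega> \<noteq> u"
begin

abbreviation Res :: "('l rloc, 'v) pcfg" where "Res \<equiv> restart C M \<omega> u"

lemma restart_sel [simp]:
  "locs Res = Old ` locs C \<union> {Decide, Stop}"
  "vars Res = insert \<omega> (insert u (vars C))"
  "outs Res = outs C"
  "init_loc Res = Old (init_loc C)"
  "init_val Res = restart_init_val C \<omega> u"
  "trans Res = restart_trans C"
  "guard Res = restart_guard C M \<omega> u"
  "upd Res = restart_upd C \<omega> u"
  "wt Res = (\<lambda>_ _. 1)"
  "term_loc Res = Stop"
  by (simp_all add: restart_def)

lemma measurable_restrict_vars [measurable]:
  "(\<lambda>x. restrict x (vars C)) \<in> valuations (insert \<omega> (insert u (vars C))) \<rightarrow>\<^sub>M valuations (vars C)"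
  by (rule measurable_restrict_subset) auto

lemma restrict_vars_space:
  "y \<in> space (valuations (insert \<omega> (insert u (vars C)))) \<Longrightarrow> restrict y (vars C) \<in> space (valuations (vars C))"
  by (rule measurable_space[OF measurable_restrict_vars])

lemma in_restart_trans_cases:
  assumes "\<tau> \<in> restart_trans C"
  obtains (old) l l' where "\<tau> = (Old l, Old l')" "(l, l') \<in> trans C" "l \<noteq> term_loc C"
    | (finish) "\<tau> = (Old (term_loc C), Decide)"
    | (again) "\<tau> = (Decide, Old (init_loc C))"
    | (stop) "\<tau> = (Decide, Stop)"
    | (loop) "\<tau> = (Stop, Stop)"
  using assms unfolding restart_trans_def by auto

lemma enabled_restart_Old:
  "l \<noteq> term_loc C \<Longrightarrow> enabled Res (Old l) y k \<longleftrightarrow> (\<exists>l'. k = Old l' \<and> enabled C l (restrict y (vars C)) l')"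
  by (auto simp: enabled_def restart_trans_def restart_guard_def)

lemma enabled_restart_term_loc: "enabled Res (Old (term_loc C)) y k \<longleftrightarrow> k = Decide"
  by (auto simp: enabled_def restart_trans_def restart_guard_def)

lemma enabled_restart_Decide:
  "enabled Res Decide y k \<longleftrightarrow> k = (if y u < 1 - y \<omega> / M then Old (init_loc C) else Stop)"
  by (auto simp: enabled_def restart_trans_def restart_guard_def)

lemma enabled_restart_Stop: "enabled Res Stop y k \<longleftrightarrow> k = Stop"
  by (auto simp: enabled_def restart_trans_def restart_guard_def)

text \<open>The two guards at \<open>Decide\<close> are complementary, \<open>Stop\<close> and the
  old terminal location have a single exit, and the other locations inherit their behaviour by
  restriction to \<open>vars C\<close>.\<close>

lemma wf_pcfg_restart: "wf_pcfg Res"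
proof (rule wf_pcfg.intro, unfold restart_sel)
  let ?V = "insert \<omega> (insert u (vars C))"
  have \<omega>[measurable]: "(\<lambda>x. x \<omega>) \<in> borel_measurable (valuations ?V)"
    and u[measurable]: "(\<lambda>x. x u) \<in> borel_measurable (valuations ?V)"
    by (auto intro!: measurable_component_singleton)
  show "finite (Old ` locs C \<union> {Decide, Stop})" using finite_locs by simp
  show "finite ?V" using finite_vars by simp
  show "outs C \<subseteq> ?V" using outs_subset by auto
  show "Old (init_loc C) \<in> Old ` locs C \<union> {Decide, Stop}" using init_loc_in by simp
  show "restart_init_val C \<omega> u \<in> space (valuations ?V)"
    using init_val_in by (auto simp: restart_init_val_def space_PiM PiE_iff extensional_def)
  show "Stop \<in> Old ` locs C \<union> {Decide, Stop}" by simp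
  show "restart_trans C \<subseteq> (Old ` locs C \<union> {Decide, Stop}) \<times> (Old ` locs C \<union> {Decide, Stop})"
    using trans_locs init_loc_in term_loc_in by (auto simp: restart_trans_def)
  show "Measurable.pred (valuations ?V) (restart_guard C M \<omega> u \<tau>)" if "\<tau> \<in> restart_trans C" for \<tau>
    using that
  proof (cases rule: in_restart_trans_cases)
    case (old l l')
    have "Measurable.pred (valuations ?V) (\<lambda>x. guard C (l, l') (restrict x (vars C)))"
      by (rule measurable_compose[OF measurable_restrict_vars guard_measurable[OF old(2)]])
    then show ?thesis by (simp add: old restart_guard_def[abs_def])
  qed (simp_all add: restart_guard_def[abs_def])
  show "e \<in> borel_measurable (valuations ?V)"
    if "\<tau> \<in> restart_trans C" "v \<in> ?V" "restart_upd C \<omega> u \<tau> v = Det e" for \<tau> v e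
    using that(1)
  proof (cases rule: in_restart_trans_cases)
    case (old l l')
    show ?thesis
    proof (cases "v = \<omega>")
      case True
      then have e: "e = (\<lambda>x. x \<omega> * wt C (l, l') (restrict x (vars C)))"
        using that(3) by (simp add: old restart_upd_def)
      have "(\<lambda>x. wt C (l, l') (restrict x (vars C))) \<in> borel_measurable (valuations ?V)"
        by (rule measurable_compose[OF measurable_restrict_vars wt_measurable[OF old(2)]])
      then show ?thesis unfolding e by measurable
    next
      case False
      then have v: "v \<in> vars C" and l: "lift_update (vars C) (upd C (l, l') v) = Det e"
        using that by (auto simp: old restart_upd_def split: if_splits)
      then obtain e' where e': "upd C (l, l') v = Det e'" "e = (\<lambda>x. e' (restrict x (vars C)))"
        by (cases "upd C (l, l') v") auto
      show ?thesis
        unfolding e'(2) by (rule measurable_compose[OF measurable_restrict_vars Det_measurable[OF old(2) v e'(1)]])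
    qed
  qed (use that(3) in \<open>auto simp: restart_upd_def split: if_splits\<close>)
  show "real_distribution d"
    if "\<tau> \<in> restart_trans C" "v \<in> ?V" "restart_upd C \<omega> u \<tau> v = Sample d" for \<tau> v d
    using that(1)
  proof (cases rule: in_restart_trans_cases)
    case (old l l')
    then have v: "v \<in> vars C" and l: "lift_update (vars C) (upd C (l, l') v) = Sample d"
      using that by (auto simp: restart_upd_def split: if_splits)
    then have "upd C (l, l') v = Sample d"
      by (cases "upd C (l, l') v") auto
    then show ?thesis by (rule Sample_distribution[OF old(2) v])
  qed (use that(3) real_distribution_uniform_01 in \<open>auto simp: restart_upd_def split: if_splits\<close>)
  show "\<exists>!k. enabled Res l y k" if "l \<in> Old ` locs C \<union> {Decide, Stop}" "y \<in> space (valuations ?V)" for l y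
  proof (cases l)
    case (Old l')
    show ?thesis
    proof (cases "l' = term_loc C")
      case False
      have "\<exists>!k. enabled C l' (restrict y (vars C)) k"
        using that Old by (intro ex1_enabled restrict_vars_space) auto
      then show ?thesis unfolding Old enabled_restart_Old[OF False] by blast
    qed (simp add: Old enabled_restart_term_loc)
  qed (simp_all add: enabled_restart_Decide enabled_restart_Stop)
  show "l' = Stop" if "(Stop, l') \<in> restart_trans C" for l'
    using that by (auto simp: restart_trans_def)
  show "restart_upd C \<omega> u (Stop, Stop) v = Keep" for v
    by (simp add: restart_upd_def)
qed simp_all

sublocale R: wf_pcfg Res
  by (rule wf_pcfg_restart)

text \<open>Couples one weighted step of \<open>C\<close> with one step of the restarting graph: the
  original variables have the same law in both, the weight is multiplied, and \<open>u\<close> is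
  integrated out.\<close>

lemma nn_integral_restart_Old:
  assumes t: "(l, l') \<in> trans C" "l \<noteq> term_loc C"
    and y: "y \<in> space (valuations (insert \<omega> (insert u (vars C))))"
    and [measurable]: "\<phi> \<in> borel_measurable (valuations (vars C) \<Otimes>\<^sub>M borel)"
  shows "(\<integral>\<^sup>+y'. \<phi> (restrict y' (vars C), y' \<omega>) \<partial>next_val Res (Old l, Old l') y) =
    (\<integral>\<^sup>+x. \<phi> (x, y \<omega> * wt C (l, l') (restrict y (vars C))) \<partial>next_val C (l, l') (restrict y (vars C)))"
proof -
  let ?V = "insert \<omega> (insert u (vars C))" and ?x = "restrict y (vars C)"
  let ?N = "next_val Res (Old l, Old l') y" and ?c = "y \<omega> * wt C (l, l') (restrict y (vars C))"
  let ?D = "\<lambda>v. value_dist (upd Res (Old l, Old l') v) y v"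
  have \<tau>: "(Old l, Old l') \<in> trans Res" using t by (auto simp: restart_trans_def)
  have y': "y \<in> space (valuations (vars Res))" using y by simp
  \<comment> \<open>The weight is updated deterministically, so it can be replaced by a constant
    under the integral.\<close>
  have "AE y' in ?N. y' \<omega> = ?c"
    using R.AE_next_val_possible[OF \<tau> y'] by eventually_elim (simp add: restart_upd_def)
  then have "(\<integral>\<^sup>+y'. \<phi> (restrict y' (vars C), y' \<omega>) \<partial>?N) = (\<integral>\<^sup>+y'. \<phi> (restrict y' (vars C), ?c) \<partial>?N)"
    by (intro nn_integral_cong_AE) auto
  also have "\<dots> = (\<integral>\<^sup>+x. \<phi> (x, ?c) \<partial>distr ?N (valuations (vars C)) (\<lambda>y'. restrict y' (vars C)))"
  proof (rule nn_integral_distr[symmetric])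
    show "(\<lambda>y'. restrict y' (vars C)) \<in> ?N \<rightarrow>\<^sub>M valuations (vars C)"
      unfolding measurable_cong_sets[OF R.sets_next_val[OF \<tau> y', unfolded restart_sel] refl]
      by (rule measurable_restrict_vars)
  qed measurable
  also have "distr ?N (valuations (vars C)) (\<lambda>y'. restrict y' (vars C)) = next_val C (l, l') ?x"
  proof -
    have D: "?D v = value_dist (upd C (l, l') v) ?x v" if "v \<in> vars C" for v
      using that fresh by (cases "upd C (l, l') v") (auto simp: restart_upd_def)
    \<comment> \<open>Reindexing along the identity yields the marginal on
      \<open>vars C\<close>.\<close>
    have "PiM (vars C) ?D = distr (PiM ?V ?D) (PiM (vars C) ?D) (\<lambda>\<omega>. \<lambda>n\<in>vars C. \<omega> (id n))"
      using R.prob_space_value_dist[OF \<tau> y'] distr_PiM_reindex[of ?V ?D id "vars C"] by simp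
    also have "\<dots> = distr ?N (valuations (vars C)) (\<lambda>y'. restrict y' (vars C))"
    proof (rule distr_cong)
      show "PiM ?V ?D = ?N" by (simp add: next_val_def)
      show "sets (PiM (vars C) ?D) = sets (valuations (vars C))"
        using R.sets_value_dist[OF \<tau> y'] by (intro sets_PiM_cong) auto
    qed simp
    finally show ?thesis
      unfolding next_val_def using PiM_cong[OF refl D, of "vars C" "\<lambda>x. x"] D by (simp cong: PiM_cong)
  qed
  finally show ?thesis .
qed

lemma vars_Int_outs [simp]: "vars C \<inter> outs C = outs C"
  using outs_subset by auto

section \<open>One attempt compared with an excessive function\<close>

context
  fixes B :: "('v \<Rightarrow> real) set" and H :: "('l rloc, 'v) state \<Rightarrow> ennreal"
  assumes B[measurable]: "B \<in> sets (valuations (outs C))"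
    and H[measurable]: "H \<in> borel_measurable (state_space Res)"
    and excessive: "\<And>s. s \<in> space (state_space Res) \<Longrightarrow> (\<integral>\<^sup>+s'. H s' \<partial>step Res s) \<le> H s"
    and H_Stop: "\<And>y. y \<in> space (valuations (vars Res)) \<Longrightarrow> indicator B (restrict y (outs C)) \<le> H (Stop, y)"
begin

lemma excessive_next_val:
  assumes "l \<in> locs Res" "y \<in> space (valuations (vars Res))" "enabled Res l y l'"
  shows "(\<integral>\<^sup>+y'. H (l', y') \<partial>next_val Res (l, l') y) \<le> H (l, y)"
  using excessive[of "(l, y)"] R.nn_integral_step[OF assms H] assms(1,2)
  by (simp only: R.space_state_space mem_Sigma_iff)

text \<open>
  The probability of an output in \<open>B\<close> when an attempt of the original program has ended with
  accumulated weight \<open>c\<close>: accept with probability \<open>c / M\<close>, restart otherwise.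
\<close>

definition terminal_value :: "('l, 'v) state \<times> real \<Rightarrow> ennreal" where
  "terminal_value = (\<lambda>((l, x), c). if l = term_loc C
     then ennreal (min 1 (c / M)) * indicator B (restrict x (outs C)) +
       ennreal (1 - min 1 (c / M)) * H (init_state Res)
     else 0)"

lemma measurable_terminal_value: "terminal_value \<in> borel_measurable (state_space C \<Otimes>\<^sub>M borel)"
proof -
  have [measurable]: "(\<lambda>x. indicator B (restrict x (outs C)) :: ennreal) \<in> borel_measurable (valuations (vars C))"
    by (rule measurable_compose[OF measurable_restrict_outs]) measurable
  define F where "F l p = (if l = term_loc C
     then ennreal (min 1 (snd p / M)) * indicator B (restrict (snd (fst p)) (outs C)) +
       ennreal (1 - min 1 (snd p / M)) * H (init_state Res)
     else 0)" for l and p :: "('l, 'v) state \<times> real"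
  have "(\<lambda>p. F (fst (fst p)) p) \<in> borel_measurable (state_space C \<Otimes>\<^sub>M borel)"
  proof (rule measurable_case_loc)
    show "F l \<in> borel_measurable (state_space C \<Otimes>\<^sub>M borel)" for l
      by (cases "l = term_loc C") (simp_all add: F_def[abs_def])
  qed simp
  then show ?thesis
    by (simp add: terminal_value_def F_def split_beta')
qed

text \<open>Excessivity is applied twice, for sampling \<open>u\<close> and for the decision. A
  restart gives all variables, including \<open>\<omega>\<close> and \<open>u\<close>, their initial
  values, so \<open>H\<close> takes the constant value \<open>H (init_state Res)\<close>
  there.\<close>

lemma terminal_value_le:
  assumes y: "y \<in> space (valuations (vars Res))" and nonneg: "0 \<le> y \<omega>" and M: "0 < M"
  shows "terminal_value ((term_loc C, restrict y (vars C)), y \<omega>) \<le> H (Old (term_loc C), y)"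
proof -
  let ?V = "vars Res"
  let ?p = "H (init_state Res)" and ?b = "indicator B (restrict y (outs C)) :: ennreal"
  let ?N = "next_val Res (Old (term_loc C), Decide) y"
  have \<tau>: "(Old (term_loc C), Decide) \<in> trans Res" "(Decide, Old (init_loc C)) \<in> trans Res" "(Decide, Stop) \<in> trans Res"
    by (auto simp: restart_trans_def)
  have ext: "y' = z" if "y' \<in> space (valuations ?V)" "z \<in> space (valuations ?V)" "\<And>v. v \<in> ?V \<Longrightarrow> y' v = z v" for y' z
    using that PiE_ext[of y' ?V "\<lambda>_. UNIV" z] by (simp add: space_PiM)
  have "terminal_value ((term_loc C, restrict y (vars C)), y \<omega>) =
     ennreal (min 1 (y \<omega> / M)) * ?b + ennreal (1 - min 1 (y \<omega> / M)) * ?p"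
    by (simp add: terminal_value_def del: restrict_apply)
  also have "\<dots> = (\<integral>\<^sup>+r. (if r < 1 - y \<omega> / M then ?p else ?b) \<partial>uniform_measure lborel {0..1::real})"
    using nonneg M by (intro nn_integral_uniform_threshold[symmetric]) simp
  also have "\<dots> = (\<integral>\<^sup>+y'. (if y' u < 1 - y \<omega> / M then ?p else ?b) \<partial>?N)"
    using R.nn_integral_next_val_component[OF \<tau>(1) y, of u "\<lambda>r. if r < 1 - y \<omega> / M then ?p else ?b"] fresh
    by (simp add: restart_upd_def)
  also have "\<dots> \<le> (\<integral>\<^sup>+y'. H (Decide, y') \<partial>?N)"
  proof (rule nn_integral_mono_AE)
    show "AE y' in ?N. (if y' u < 1 - y \<omega> / M then ?p else ?b) \<le> H (Decide, y')"
      using R.AE_next_val_possible[OF \<tau>(1) y] AE_space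
    proof eventually_elim
      case (elim y')
      then have y': "y' \<in> space (valuations ?V)" using R.space_next_val[OF \<tau>(1) y] by blast
      have same: "y' v = y v" if "v \<in> ?V" "v \<noteq> u" for v
        using elim(1) that by (auto simp: restart_upd_def dest: bspec[of _ _ v])
      have outs: "restrict y' (outs C) = restrict y (outs C)"
        using same fresh outs_subset by (auto simp: restrict_def fun_eq_iff)
      have yw: "y' \<omega> = y \<omega>" using same fresh by simp
      define k where "k = (if y' u < 1 - y \<omega> / M then Old (init_loc C) else Stop)"
      have en: "enabled Res Decide y' k" by (simp add: enabled_restart_Decide k_def yw)
      have \<tau>k: "(Decide, k) \<in> trans Res" using en by (simp add: enabled_def)
      have "(if y' u < 1 - y \<omega> / M then ?p else ?b) \<le> (\<integral>\<^sup>+z. H (k, z) \<partial>next_val Res (Decide, k) y')"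
      proof (cases "y' u < 1 - y \<omega> / M")
        case True
        have k: "k = Old (init_loc C)" using True by (simp add: k_def)
        have "AE z in next_val Res (Decide, k) y'. H (k, z) = ?p"
          using R.AE_next_val_possible[OF \<tau>k y'] AE_space
        proof eventually_elim
          case (elim z)
          have "z \<in> space (valuations ?V)" using elim(2) R.space_next_val[OF \<tau>k y'] by blast
          then have "z = init_val Res"
            using elim(1) by (intro ext R.init_val_in) (auto simp: restart_upd_def k)
          then show ?case by (simp add: k)
        qed
        then have "(\<integral>\<^sup>+z. H (k, z) \<partial>next_val Res (Decide, k) y') = ?p"
          by (rule nn_integral_AE_const[OF R.prob_space_next_val[OF \<tau>k y']])
        then show ?thesis using True by simp
      next
        case False
        have k: "k = Stop" using False by (simp add: k_def)
        have "AE z in next_val Res (Decide, k) y'. H (k, z) = H (Stop, y')"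
          using R.AE_next_val_possible[OF \<tau>k y'] AE_space
        proof eventually_elim
          case (elim z)
          have "z \<in> space (valuations ?V)" using elim(2) R.space_next_val[OF \<tau>k y'] by blast
          then have "z = y'"
            using elim(1) by (intro ext y') (auto simp: restart_upd_def k)
          then show ?case by (simp add: k)
        qed
        then have "(\<integral>\<^sup>+z. H (k, z) \<partial>next_val Res (Decide, k) y') = H (Stop, y')"
          by (rule nn_integral_AE_const[OF R.prob_space_next_val[OF \<tau>k y']])
        then show ?thesis using False H_Stop[OF y'] outs by simp
      qed
      also have "\<dots> \<le> H (Decide, y')"
        by (rule excessive_next_val[OF _ y' en]) simp
      finally show ?case .
    qed
  qed
  also have "\<dots> \<le> H (Old (term_loc C), y)"
    using term_loc_in by (intro excessive_next_val[OF _ y]) (auto simp: enabled_restart_term_loc)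
  finally show ?thesis .
qed

text \<open>One attempt of \<open>C\<close>, paid off by \<open>terminal_value\<close> if it has
  ended after \<open>n\<close> steps, is worth at most \<open>H\<close>. While the attempt goes on,
  both graphs take corresponding steps, and excessivity absorbs each of them.\<close>

lemma weighted_step_funpow_le:
  assumes "l \<in> locs C" "y \<in> space (valuations (vars Res))" "0 \<le> y \<omega>" "0 < M"
  shows "(weighted_step ^^ n) terminal_value ((l, restrict y (vars C)), y \<omega>) \<le> H (Old l, y)"
  using assms
proof (induction n arbitrary: l y)
  case 0
  then show ?case
    using terminal_value_le[of y] by (cases "l = term_loc C") (auto simp: terminal_value_def simp del: restrict_apply)
next
  case (Suc n)
  define \<psi> where "\<psi> = (weighted_step ^^ n) terminal_value"
  define x where "x = restrict y (vars C)"
  have \<psi>[measurable]: "\<psi> \<in> borel_measurable (state_space C \<Otimes>\<^sub>M borel)"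
    unfolding \<psi>_def by (rule measurable_weighted_step_funpow[OF measurable_terminal_value])
  have y: "y \<in> space (valuations (insert \<omega> (insert u (vars C))))" using Suc.prems by simp
  have x: "x \<in> space (valuations (vars C))" unfolding x_def by (rule restrict_vars_space[OF y])
  have s: "(l, x) \<in> space (state_space C)" using x Suc.prems by (simp add: space_state_space)
  have ws: "(weighted_step ^^ Suc n) terminal_value ((l, x), y \<omega>) =
      (\<integral>\<^sup>+s'. \<psi> (s', y \<omega> * wgt (l, x) s') \<partial>step C (l, x))"
    by (simp add: \<psi>_def[symmetric] weighted_step_def)
  show ?case unfolding x_def[symmetric]
  proof (cases "l = term_loc C")
    case True
    \<comment> \<open>Here \<open>C\<close> idles with weight 1, whereas the restarting graph would
      move to \<open>Decide\<close>. The latter is held back, and the induction hypothesis is used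
      at the same state.\<close>
    have "AE s' in step C (l, x). \<psi> (s', y \<omega> * wgt (l, x) s') = \<psi> ((l, x), y \<omega>)"
      using AE_step_successor[OF s]
    proof eventually_elim
      case (elim s')
      then have "s' = (l, x)" using successor_term_loc[OF elim] True by simp
      moreover have "(l, l) \<in> trans C" using elim calculation by (simp add: successor_def enabled_def)
      ultimately show ?case using True x by (simp add: wgt_def term_wt)
    qed
    then have "(weighted_step ^^ Suc n) terminal_value ((l, x), y \<omega>) = \<psi> ((l, x), y \<omega>)"
      unfolding ws by (rule nn_integral_AE_const[OF prob_space_step[OF s]])
    also have "\<dots> \<le> H (Old l, y)" unfolding \<psi>_def x_def by (rule Suc.IH[OF Suc.prems])
    finally show "(weighted_step ^^ Suc n) terminal_value ((l, x), y \<omega>) \<le> H (Old l, y)" .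
  next
    case False
    define l' where "l' = next_loc l x"
    define c where "c = y \<omega> * wt C (l, l') x"
    have en: "enabled C l x l'" and t: "(l, l') \<in> trans C"
      using enabled_next_loc next_loc_trans Suc.prems(1) x by (auto simp: l'_def)
    have l': "l' \<in> locs C" using trans_locs(2)[OF t] .
    have enR: "enabled Res (Old l) y (Old l')"
      using en by (simp add: enabled_restart_Old[OF False] x_def del: restrict_apply)
    have \<tau>: "(Old l, Old l') \<in> trans Res" using enR by (simp add: enabled_def)
    have c: "0 \<le> c" unfolding c_def using Suc.prems(3) wt_nonneg[OF t x] by simp
    have "(weighted_step ^^ Suc n) terminal_value ((l, x), y \<omega>) = (\<integral>\<^sup>+x'. \<psi> ((l', x'), c) \<partial>next_val C (l, l') x)"
    proof -
      have "(\<lambda>s'. \<psi> (s', y \<omega> * wgt (l, x) s')) \<in> borel_measurable (state_space C)"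
        using s by measurable
      from nn_integral_step[OF Suc.prems(1) x en this] show ?thesis
        unfolding ws by (simp add: wgt_def t c_def)
    qed
    also have "\<dots> = (\<integral>\<^sup>+y'. \<psi> ((l', restrict y' (vars C)), y' \<omega>) \<partial>next_val Res (Old l, Old l') y)"
    proof -
      have "(\<lambda>p. \<psi> ((l', fst p), snd p)) \<in> borel_measurable (valuations (vars C) \<Otimes>\<^sub>M borel)"
        by (rule measurable_compose[OF _ \<psi>])
           (intro measurable_Pair measurable_compose[OF measurable_fst measurable_Pair_state[OF l']] measurable_snd)
      from nn_integral_restart_Old[OF t False y this]
      show ?thesis by (simp add: c_def x_def del: restrict_apply)
    qed
    also have "\<dots> \<le> (\<integral>\<^sup>+y'. H (Old l', y') \<partial>next_val Res (Old l, Old l') y)"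
    proof (rule nn_integral_mono_AE)
      show "AE y' in next_val Res (Old l, Old l') y. \<psi> ((l', restrict y' (vars C)), y' \<omega>) \<le> H (Old l', y')"
        using R.AE_next_val_possible[OF \<tau> Suc.prems(2)] AE_space
      proof eventually_elim
        case (elim y')
        have y': "y' \<in> space (valuations (vars Res))"
          using elim(2) R.space_next_val[OF \<tau> Suc.prems(2)] by blast
        have "y' \<omega> = c" using elim(1) by (simp add: restart_upd_def c_def x_def del: restrict_apply)
        then show ?case unfolding \<psi>_def using c by (intro Suc.IH l' y' Suc.prems(4)) simp
      qed
    qed
    also have "\<dots> \<le> H (Old l, y)"
      using Suc.prems(1) by (intro excessive_next_val[OF _ Suc.prems(2) enR]) simp
    finally show "(weighted_step ^^ Suc n) terminal_value ((l, x), y \<omega>) \<le> H (Old l, y)" .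
  qed
qed

text \<open>The initial value 1 of \<open>\<omega>\<close> is the empty product with which
  \<open>acc_weight\<close> starts.\<close>

lemma nn_integral_terminal_value_le:
  assumes "0 < M"
  shows "(\<integral>\<^sup>+\<rho>. terminal_value (\<rho> n, acc_weight n \<rho>) \<partial>run_measure C) \<le> H (init_state Res)"
proof -
  have "restrict (restart_init_val C \<omega> u) (vars C) = init_val C"
    using fresh init_val_in by (auto simp: restart_init_val_def space_PiM PiE_iff extensional_def fun_eq_iff)
  moreover have "restart_init_val C \<omega> u \<omega> = 1"
    using fresh by (simp add: restart_init_val_def)
  ultimately show ?thesis
    using weighted_step_funpow_le[OF init_loc_in R.init_val_in _ assms, of n]
    by (simp add: nn_integral_acc_weight[OF measurable_terminal_value] del: restrict_apply)
qed

end

section \<open>The output law of the restarting graph\<close>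

lemma prob_output_ge_nod:
  assumes ast: "as_terminating C" and int: "integrable_pcfg C" and bound: "weight_bound C M"
    and B[measurable]: "B \<in> sets (valuations (outs C))"
  shows "nod C B \<le> measure (run_measure Res) (output_runs Res B)"
proof -
  have M: "0 < M" using bound by (simp add: weight_bound_def)
  obtain H :: "('l rloc, 'v) state \<Rightarrow> ennreal" where H: "H \<in> borel_measurable (state_space Res)"
    "\<And>s. s \<in> space (state_space Res) \<Longrightarrow> (\<integral>\<^sup>+s'. H s' \<partial>step Res s) \<le> H s"
    "\<And>y. y \<in> space (valuations (vars Res)) \<Longrightarrow> indicator B (restrict y (outs C)) \<le> H (Stop, y)"
    and H_init: "H (init_state Res) \<le> emeasure (run_measure Res) (output_runs Res B)"
    by (rule R.ex_excessive[of B]) (use B in simp_all)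
  note tv = nn_integral_terminal_value_le[OF B H M] and tv_def = terminal_value_def[OF B H]
  let ?tv = "terminal_value B H"
  \<comment> \<open>The recursive inequality is shown for this value of \<open>H\<close>, not for
    the probability of an output in \<open>B\<close>; the latter is at least \<open>p\<close> and
    enters at the end.\<close>
  define p where "p = H (init_state Res)"
  have "p \<le> 1" using H_init R.emeasure_le_1 order_trans unfolding p_def by blast
  then obtain r where r: "p = ennreal r" "0 \<le> r"
    by (metis ennreal_cases ennreal_one_neq_top top_unique)
  define W where "W = cum_weight C"
  have [measurable]: "W \<in> borel_measurable (run_measure C)" and intW: "integrable (run_measure C) W"
    and pos: "0 < (\<integral>\<rho>. W \<rho> \<partial>run_measure C)"
    using int by (auto simp: integrable_pcfg_def W_def)
  have ind[measurable]: "(\<lambda>\<rho>. indicator (output_runs C B) \<rho> :: real) \<in> borel_measurable (run_measure C)"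
    using measurable_output_runs[OF B] by (rule borel_measurable_indicator)
  have good: "AE \<rho> in run_measure C. \<rho> \<in> runs C \<and> (\<exists>n. fst (\<rho> n) = term_loc C)"
    using AE_runs ast[unfolded as_terminating_def term_time_finite_iff] by eventually_elim auto
  have W_eq: "0 \<le> W \<rho>" "W \<rho> \<le> M" if \<rho>: "\<rho> \<in> runs C" "\<exists>n. fst (\<rho> n) = term_loc C" for \<rho>
  proof -
    obtain n where n: "fst (\<rho> n) = term_loc C" using \<rho> by blast
    have "0 \<le> acc_weight n \<rho>"
      unfolding acc_weight_def using run_in_space runs_subset_space \<rho> by (intro prod_nonneg wgt_nonneg) blast
    then show "0 \<le> W \<rho>" using acc_weight_eq_cum_weight[OF \<rho>(1) n] by (simp add: W_def)
    show "W \<rho> \<le> M"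
      using bound \<rho> term_time_finite_iff[of \<rho>] unfolding weight_bound_def W_def by blast
  qed
  define A where "A = (\<integral>\<rho>. W \<rho> \<partial>run_measure C)"
  define a where "a = (\<integral>\<rho>. indicator (output_runs C B) \<rho> * W \<rho> \<partial>run_measure C)"
  have intIW: "integrable (run_measure C) (\<lambda>\<rho>. indicator (output_runs C B) \<rho> * W \<rho>)"
    using integrable_mult_indicator[OF measurable_output_runs[OF B] intW] by simp
  \<comment> \<open>The integrand is the eventual value of \<open>?tv\<close> along a terminating
    run. Fatou's lemma then moves the limit inferior outside the integral, where every term is at
    most \<open>p\<close>.\<close>
  have "(\<integral>\<^sup>+\<rho>. ennreal (W \<rho> / M * indicator (output_runs C B) \<rho> + (1 - W \<rho> / M) * r) \<partial>run_measure C)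
      \<le> (\<integral>\<^sup>+\<rho>. liminf (\<lambda>n. ?tv (\<rho> n, acc_weight n \<rho>)) \<partial>run_measure C)"
  proof (rule nn_integral_mono_AE)
    show "AE \<rho> in run_measure C. ennreal (W \<rho> / M * indicator (output_runs C B) \<rho> + (1 - W \<rho> / M) * r)
        \<le> liminf (\<lambda>n. ?tv (\<rho> n, acc_weight n \<rho>))"
      using good
    proof eventually_elim
      case (elim \<rho>)
      then obtain t where t: "fst (\<rho> t) = term_loc C" by blast
      \<comment> \<open>The weight bound makes the cap \<open>min 1\<close> in
        \<open>terminal_value\<close> the identity.\<close>
      have w: "0 \<le> W \<rho> / M" "W \<rho> / M \<le> 1" using W_eq[of \<rho>] elim M by auto
      have "?tv (\<rho> n, acc_weight n \<rho>) = ennreal (W \<rho> / M * indicator (output_runs C B) \<rho> + (1 - W \<rho> / M) * r)"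
        if "t \<le> n" for n
      proof -
        have n: "fst (\<rho> n) = term_loc C" using runs_stay[OF conjunct1[OF elim] t that] t by simp
        have o: "indicator B (restrict (snd (\<rho> n)) (outs C)) = (indicator (output_runs C B) \<rho> :: real)"
          using elim by (simp add: out_val_eq[OF conjunct1[OF elim] n, symmetric] output_runs_eq indicator_def del: restrict_apply)
        have "?tv (\<rho> n, acc_weight n \<rho>) = ennreal (W \<rho> / M) * indicator B (restrict (snd (\<rho> n)) (outs C)) + ennreal (1 - W \<rho> / M) * p"
          using n w acc_weight_eq_cum_weight[OF conjunct1[OF elim] n]
          by (simp add: tv_def split_beta' W_def p_def min_absorb2 del: restrict_apply restart_sel)
        also have "\<dots> = ennreal (W \<rho> / M * indicator (output_runs C B) \<rho> + (1 - W \<rho> / M) * r)"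
          using w r unfolding o[symmetric]
          by (cases "restrict (snd (\<rho> n)) (outs C) \<in> B")
             (simp_all add: ennreal_plus[symmetric] ennreal_mult[symmetric] del: restrict_apply ennreal_plus)
        finally show ?thesis .
      qed
      then show ?case by (intro Liminf_bounded eventually_sequentiallyI[of t]) simp
    qed
  qed
  also have "\<dots> \<le> liminf (\<lambda>n. \<integral>\<^sup>+\<rho>. ?tv (\<rho> n, acc_weight n \<rho>) \<partial>run_measure C)"
  proof (rule nn_integral_liminf)
    show "(\<lambda>\<rho>. ?tv (\<rho> n, acc_weight n \<rho>)) \<in> borel_measurable (run_measure C)" for n
      by (rule measurable_compose[OF _ measurable_terminal_value[OF B H]]) measurable
  qed
  also have "\<dots> \<le> p"
    unfolding p_def by (intro Liminf_le always_eventually allI tv) simp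
  also have "(\<integral>\<^sup>+\<rho>. ennreal (W \<rho> / M * indicator (output_runs C B) \<rho> + (1 - W \<rho> / M) * r) \<partial>run_measure C)
      = ennreal (\<integral>\<rho>. W \<rho> / M * indicator (output_runs C B) \<rho> + (1 - W \<rho> / M) * r \<partial>run_measure C)"
  proof (rule nn_integral_eq_integral)
    show "integrable (run_measure C) (\<lambda>\<rho>. W \<rho> / M * indicator (output_runs C B) \<rho> + (1 - W \<rho> / M) * r)"
      using intIW intW by (auto simp: field_simps)
    show "AE \<rho> in run_measure C. 0 \<le> W \<rho> / M * indicator (output_runs C B) \<rho> + (1 - W \<rho> / M) * r"
      using good
    proof eventually_elim
      case (elim \<rho>)
      then have "0 \<le> W \<rho> / M" "W \<rho> / M \<le> 1" using W_eq[of \<rho>] M by auto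
      then show ?case using r by (intro add_nonneg_nonneg mult_nonneg_nonneg) auto
    qed
  qed
  also have "(\<integral>\<rho>. W \<rho> / M * indicator (output_runs C B) \<rho> + (1 - W \<rho> / M) * r \<partial>run_measure C) = a / M + (1 - A / M) * r"
  proof -
    have "(\<integral>\<rho>. W \<rho> / M * indicator (output_runs C B) \<rho> + (1 - W \<rho> / M) * r \<partial>run_measure C) =
        (\<integral>\<rho>. (indicator (output_runs C B) \<rho> * W \<rho>) / M + (1 - W \<rho> / M) * r \<partial>run_measure C)"
      by (simp add: mult.commute)
    also have "\<dots> = a / M + (1 - A / M) * r"
      using intIW intW by (simp add: a_def A_def prob_space)
    finally show ?thesis .
  qed
  finally have "a / M + (1 - A / M) * r \<le> r"
    using r by (simp add: ennreal_le_iff)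
  \<comment> \<open>Cancelling \<open>r\<close> leaves \<open>a / M \<le> (A / M) * r\<close>, and
    the expected weight \<open>A\<close> is positive.\<close>
  then have "a / A \<le> r"
    using M pos by (simp add: A_def field_simps)
  moreover have "r \<le> measure (run_measure Res) (output_runs Res B)"
    using H_init unfolding p_def[symmetric] r(1) R.emeasure_eq_measure by simp
  ultimately show ?thesis
    by (simp add: nod_def a_def A_def W_def)
qed

context
  assumes ast: "as_terminating C" and int: "integrable_pcfg C" and bound: "weight_bound C M"
begin

lemma prob_output_restart:
  assumes B: "B \<in> sets (valuations (outs C))"
  shows "measure (run_measure Res) (output_runs Res B) = nod C B"
proof -
  let ?B' = "space (valuations (outs C)) - B"
  have B': "?B' \<in> sets (valuations (outs C))" using B by auto
  have m: "output_runs Res D \<in> sets (run_measure Res)" if "D \<in> sets (valuations (outs C))" for D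
    using R.measurable_output_runs[of D] that by simp
  have "measure (run_measure Res) (output_runs Res B) + measure (run_measure Res) (output_runs Res ?B') =
      measure (run_measure Res) (output_runs Res B \<union> output_runs Res ?B')"
    by (intro R.finite_measure_Union[symmetric] m B B') (auto simp: R.output_runs_eq)
  also have "\<dots> \<le> 1" by (rule R.prob_le_1)
  finally show ?thesis
    using prob_output_ge_nod[OF ast int bound B] prob_output_ge_nod[OF ast int bound B'] nod_compl[OF ast int B]
    by linarith
qed

text \<open>The set of all outputs has normalised mass 1, so by \<open>prob_output_restart\<close>
  an output is produced with probability 1.\<close>

lemma as_terminating_restart: "as_terminating Res"
proof -
  let ?S = "space (valuations (outs C))"
  have "nod C {} = 0" by (simp add: nod_def output_runs_def)
  then have "measure (run_measure Res) (output_runs Res ?S) = 1"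
    using prob_output_restart[of ?S] nod_compl[OF ast int, of ?S] by simp
  moreover have "output_runs Res ?S \<in> sets (run_measure Res)"
    using R.measurable_output_runs[of ?S] by simp
  ultimately have "AE \<rho> in run_measure Res. \<rho> \<in> output_runs Res ?S"
    using R.prob_eq_1 by blast
  then show ?thesis
    unfolding as_terminating_def R.term_time_finite_iff
    by eventually_elim (simp add: R.output_runs_eq)
qed

text \<open>Turns equality of normalised output distributions into equality of measures, hence of
  the expectations of \<open>f\<close>.\<close>

lemma emeasure_distr_out_val:
  assumes B: "B \<in> sets (valuations (outs C))"
  shows "emeasure (distr (run_measure Res) (valuations (outs C)) R.out_val) B = ennreal (nod C B)"
proof -
  have out[measurable]: "R.out_val \<in> run_measure Res \<rightarrow>\<^sub>M valuations (outs C)"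
    using R.measurable_out_val by simp
  have "emeasure (distr (run_measure Res) (valuations (outs C)) R.out_val) B =
      emeasure (run_measure Res) (R.out_val -` B \<inter> space (run_measure Res))"
    by (rule emeasure_distr[OF out B])
  also have "\<dots> = emeasure (run_measure Res) (output_runs Res B)"
  proof (rule emeasure_eq_AE)
    show "AE \<rho> in run_measure Res. \<rho> \<in> R.out_val -` B \<inter> space (run_measure Res) \<longleftrightarrow> \<rho> \<in> output_runs Res B"
      using R.AE_runs as_terminating_restart[unfolded as_terminating_def R.term_time_finite_iff] AE_space
      by eventually_elim (auto simp: R.output_runs_eq)
    show "R.out_val -` B \<inter> space (run_measure Res) \<in> sets (run_measure Res)"
      by (rule measurable_sets[OF out B])
    show "output_runs Res B \<in> sets (run_measure Res)"
      using R.measurable_output_runs[of B] B by simp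
  qed
  finally show ?thesis
    by (simp add: R.emeasure_eq_measure prob_output_restart[OF B])
qed

end

end

theorem theorem2:
  fixes C1 :: "('l1, 'v) pcfg" and C2 :: "('l2, 'v) pcfg"
    and M1 M2 :: real and \<omega>1 u1 \<omega>2 u2 :: 'v
    and f :: "('v \<Rightarrow> real) \<Rightarrow> real"
    and U :: "('l1 rloc, 'v) state_fun" and L :: "('l2 rloc, 'v) state_fun"
  assumes wf: "wf_pcfg C1" "wf_pcfg C2"
    and ast: "as_terminating C1" "as_terminating C2"
    and integrable: "integrable_pcfg C1" "integrable_pcfg C2"
    and bounded: "weight_bound C1 M1" "weight_bound C2 M2"
    and same_outputs: "outs C1 = outs C2"
    and fresh1: "\<omega>1 \<notin> vars C1" "u1 \<notin> vars C1" "\<omega>1 \<noteq> u1"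
    and fresh2: "\<omega>2 \<notin> vars C2" "u2 \<notin> vars C2" "\<omega>2 \<noteq> u2"
    and f: "f \<in> borel_measurable (valuations (outs C1))"
    and upper: "\<exists>I. invariant (restart C1 M1 \<omega>1 u1) I \<and> UESM (restart C1 M1 \<omega>1 u1) I f U"
      "ost_sound (restart C1 M1 \<omega>1 u1) U f"
    and lower: "\<exists>I. invariant (restart C2 M2 \<omega>2 u2) I \<and> LESM (restart C2 M2 \<omega>2 u2) I f L"
      "ost_sound (restart C2 M2 \<omega>2 u2) L f"
    and gap:
      "U (init_loc (restart C1 M1 \<omega>1 u1)) (init_val (restart C1 M1 \<omega>1 u1)) +
         f (restrict (init_val (restart C1 M1 \<omega>1 u1)) (outs C1)) <
       L (init_loc (restart C2 M2 \<omega>2 u2)) (init_val (restart C2 M2 \<omega>2 u2)) +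
         f (restrict (init_val (restart C2 M2 \<omega>2 u2)) (outs C2))"
  shows "\<exists>B\<in>sets (valuations (outs C1)). nod C1 B \<noteq> nod C2 B"
proof (rule ccontr)
  assume "\<not> (\<exists>B\<in>sets (valuations (outs C1)). nod C1 B \<noteq> nod C2 B)"
  then have eq: "nod C1 B = nod C2 B" if "B \<in> sets (valuations (outs C1))" for B
    using that by blast
  interpret W1: weighted_restart C1 M1 \<omega>1 u1
    using wf(1) fresh1 by (simp add: weighted_restart_def weighted_restart_axioms_def)
  interpret W2: weighted_restart C2 M2 \<omega>2 u2
    using wf(2) fresh2 by (simp add: weighted_restart_def weighted_restart_axioms_def)
  obtain I1 where I1: "invariant W1.Res I1" "UESM W1.Res I1 f U" using upper(1) by blast
  obtain I2 where I2: "invariant W2.Res I2" "LESM W2.Res I2 f L" using lower(1) by blast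
  let ?D1 = "distr (run_measure W1.Res) (valuations (outs C1)) W1.R.out_val"
  let ?D2 = "distr (run_measure W2.Res) (valuations (outs C2)) W2.R.out_val"
  \<comment> \<open>Output equivalence gives both restarting graphs the same output law, so the
    upper and the lower bound concern one and the same expectation of \<open>f\<close>.\<close>
  have D: "?D1 = ?D2"
  proof (rule measure_eqI)
    fix B assume "B \<in> sets ?D1"
    then have B: "B \<in> sets (valuations (outs C1))" "B \<in> sets (valuations (outs C2))"
      by (auto simp: same_outputs)
    show "emeasure ?D1 B = emeasure ?D2 B"
      unfolding W1.emeasure_distr_out_val[OF ast(1) integrable(1) bounded(1) B(1)]
        W2.emeasure_distr_out_val[OF ast(2) integrable(2) bounded(2) B(2)] eq[OF B(1)] ..
  qed (simp add: same_outputs)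
  have f2: "f \<in> borel_measurable (valuations (outs C2))" using f by (simp add: same_outputs)
  have out: "W1.R.out_val \<in> run_measure W1.Res \<rightarrow>\<^sub>M valuations (outs C1)"
    "W2.R.out_val \<in> run_measure W2.Res \<rightarrow>\<^sub>M valuations (outs C2)"
    using W1.R.measurable_out_val W2.R.measurable_out_val by simp_all
  have "(\<integral>\<rho>. f (W1.R.out_val \<rho>) \<partial>run_measure W1.Res) = (\<integral>x. f x \<partial>?D1)"
    by (rule integral_distr[OF out(1) f, symmetric])
  also have "\<dots> = (\<integral>\<rho>. f (W2.R.out_val \<rho>) \<partial>run_measure W2.Res)"
    unfolding D by (rule integral_distr[OF out(2) f2])
  finally have same: "(\<integral>\<rho>. f (W1.R.out_val \<rho>) \<partial>run_measure W1.Res) = (\<integral>\<rho>. f (W2.R.out_val \<rho>) \<partial>run_measure W2.Res)" .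
  have "(\<integral>\<rho>. f (W1.R.out_val \<rho>) \<partial>run_measure W1.Res) \<le>
      U (init_loc W1.Res) (init_val W1.Res) + f (restrict (init_val W1.Res) (outs W1.Res))"
    using W1.as_terminating_restart[OF ast(1) integrable(1) bounded(1)] I1 upper(2) f
    by (intro W1.R.UESM_bound(2)) simp_all
  \<comment> \<open>The lower bound on the expectation of \<open>f\<close> is the UESM bound for
    \<open>- L\<close> and \<open>- f\<close>, with signs reversed.\<close>
  moreover have "(\<integral>\<rho>. - f (W2.R.out_val \<rho>) \<partial>run_measure W2.Res) \<le>
      - L (init_loc W2.Res) (init_val W2.Res) + - f (restrict (init_val W2.Res) (outs W2.Res))"
    using W2.as_terminating_restart[OF ast(2) integrable(2) bounded(2)] I2(1) UESM_uminus[OF I2(2)]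
      ost_sound_uminus[OF lower(2)] f2
    by (intro W2.R.UESM_bound(2)) simp_all
  ultimately show False
    using gap same by simp
qed

end
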